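(* There is a bigraded injective Lie algebra morphism $\mathfrak{ls}\hookrightarrow\mathfrak{lkv}$ making the square formed with the injection $gr\,\mathfrak{ds}\hookrightarrow gr\,\mathfrak{krv}$ (top), $gr\,\mathfrak{ds}\hookrightarrow\mathfrak{ls}$ (left) and $gr\,\mathfrak{krv}\hookrightarrow\mathfrak{lkv}$ (right) commute. Moreover, for all $n\ge3$ and $r\in\{1,2,3\}$ it restricts to an isomorphism $\mathfrak{ls}_n^r\simeq\mathfrak{lkv}_n^r$ of the parts of weight $n$ and depth $r$.
   Context: Let $\mathfrak{lie}_2$ be the degree completion of the free Lie algebra over $\mathbb{Q}$ on $x,y$, inside $\mathrm{Ass}_2=\mathbb{Q}\langle\langle x,y\rangle\rangle$; weight = degree, depth = $y$-degree. $C_i=\mathrm{ad}(x)^{i-1}(y)$, $\mathfrak{lie}_C$ is the completed Lie subalgebra generated by the $C_i$. Write $f=c+f_xx+f_yy=c+xf^x+yf^y$ for $f\in\mathrm{Ass}_2$ with constant term $c$; $(f|w)$ is the coefficient of the word $w$ in $f$. Poisson bracket: $\{f,g\}=[f,g]+d_f(g)-d_g(f)$, where $d_f(x)=0,\ d_f(y)=[y,f]$. $\mathfrak{ds}$ (double shuffle Lie algebra): for $f\in\mathrm{Ass}_2$ let $\pi_y(f)=f_yy$ rewritten as a noncommutative series in $y_i=x^{i-1}y$ ($i\ge1$), and $f_*=\pi_y(f)+\sum_{n\ge2}\frac{(-1)^{n-1}}{n}(f|x^{n-1}y)y_1^n$. $\mathfrak{ds}$ is the space of $f\in\mathfrak{lie}_2$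 with homogeneous components of weight $\ge3$ such that $f_*$ is primitive for the coproduct $\Delta_*(y_i)=\sum_{j+k=i}y_j\otimes y_k$ ($y_0=1$); it is a Lie algebra under the Poisson bracket, filtered by depth (lowest $y$-degree), with associated graded $gr\,\mathfrak{ds}$. $\mathfrak{ls}$: the span of the $f\in\mathfrak{lie}_2$ homogeneous of weight $n\ge3$ and of fixed depth such that $f_yy$, rewritten in the $y_i$, lies in the free Lie algebra on the $y_i$, and such that $n$ is odd if $f$ has depth 1; it is a bigraded Lie algebra under the Poisson bracket, and $gr\,\mathfrak{ds}\hookrightarrow\mathfrak{ls}$ sends a class to the lowest-depth part of a representative. $\mathfrak{krv}$: tangential derivations $E_{a,b}$ ($a$ without linear $x$-term, $b$ without linear $y$-term) with $E_{a,b}(x)=[x,a]$, $E_{a,b}(y)=[y,b]$; $\mathfrak{sder}_2$ those with $[x,a]+[y,b]=0$; $\mathrm{tr}$ the projection of $\mathrm{Ass}_2$ to its quotient by cyclic permutation of words; $\mathrm{div}(E_{a,b})=\mathrm{tr}(a_xx+b_yy)$; $\mathfrak{krv}$ is the weight-$\ge3$ part of the Lie algebra of $E_{a,b}\in\mathfrak{sder}_2$ with $\mathrm{div}(E_{a,b})=\mathrm{tr}(h(x+y)-h(x)-h(y))$ for some power series $h$ of degree $\ge2$. Depth of $E_{a,b}$ = lowest $y$-degree in $b$; $gr\,\mathfrak{krv}$ is the associated graded. The injection $\mathfrak{ds}\hookrightarrow\mathfrak{krv}$ sends $f(x,y)$ to the element $E_{a,b}$ with $b=f(-x-y,-y)$,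 and it induces $gr\,\mathfrak{ds}\hookrightarrow gr\,\mathfrak{krv}$. $\mathfrak{lkv}$: push operator $push(x^{a_0}yx^{a_1}\cdots yx^{a_r})=x^{a_r}yx^{a_0}y\cdots yx^{a_{r-1}}$ extended linearly; $p$ of depth $s$ is push-neutral if $\sum_{i=0}^spush^i(p)=0$. $\mathfrak{lkv}$ is the space of $b\in\mathfrak{lie}_C$ with components of weight $\ge3$ such that $push(b)=b$ and for each $r\ge2$, $(b^{(r)})^y$ is push-neutral, where $b^{(r)}$ is the depth-$r$ part of $b$; it is bigraded with parts $\mathfrak{lkv}_n^r$ and carries the Poisson bracket. The map $gr\,\mathfrak{krv}\hookrightarrow\mathfrak{lkv}$ sends the class of $E_{a,b}$ of depth $r$ to the depth-$r$ part of $b$. *)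

theory Defs
  imports Complex_Main
begin

datatype letter = X | Y

text \<open>A (completed) noncommutative power series over Q is its coefficient function on words.\<close>
type_synonym 'a ser = "'a list \<Rightarrow> rat"

definition szero :: "'a ser" where "szero = (\<lambda>_. 0)"
definition sadd :: "'a ser \<Rightarrow> 'a ser \<Rightarrow> 'a ser" where "sadd f g = (\<lambda>w. f w + g w)"
definition ssub :: "'a ser \<Rightarrow> 'a ser \<Rightarrow> 'a ser" where "ssub f g = (\<lambda>w. f w - g w)"
definition sscale :: "rat \<Rightarrow> 'a ser \<Rightarrow> 'a ser" where "sscale c f = (\<lambda>w. c * f w)"

definition smult :: "'a ser \<Rightarrow> 'a ser \<Rightarrow> 'a ser" where
  "smult f g = (\<lambda>w. \<Sum>i\<in>{0..length w}. f (take i w) * g (drop i w))"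
definition sbr :: "'a ser \<Rightarrow> 'a ser \<Rightarrow> 'a ser" where
  "sbr f g = ssub (smult f g) (smult g f)"

definition mono :: "'a list \<Rightarrow> 'a ser" where "mono w = (\<lambda>u. if u = w then 1 else 0)"

definition hpart :: "nat \<Rightarrow> 'a ser \<Rightarrow> 'a ser" where
  "hpart n f = (\<lambda>w. if length w = n then f w else 0)"

inductive_set lie_gen :: "'a ser set \<Rightarrow> 'a ser set" for G where
  gen: "g \<in> G \<Longrightarrow> g \<in> lie_gen G"
| zero: "szero \<in> lie_gen G"
| add: "f \<in> lie_gen G \<Longrightarrow> g \<in> lie_gen G \<Longrightarrow> sadd f g \<in> lie_gen G"
| scale: "f \<in> lie_gen G \<Longrightarrow> sscale c f \<in> lie_gen G"
| br: "f \<in> lie_gen G \<Longrightarrow> g \<in> lie_gen G \<Longrightarrow> sbr f g \<in> lie_gen G"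

text \<open>Degree completion (for homogeneous generators): every homogeneous component lies in
  the Lie subalgebra generated by G.\<close>
definition lie_compl :: "'a ser set \<Rightarrow> 'a ser set" where
  "lie_compl G = {f. \<forall>n. hpart n f \<in> lie_gen G}"

definition xs :: "letter ser" where "xs = mono [X]"
definition ys :: "letter ser" where "ys = mono [Y]"

definition lie2 :: "letter ser set" where "lie2 = lie_compl {xs, ys}"

definition Cgen :: "nat \<Rightarrow> letter ser" where "Cgen i = ((sbr xs) ^^ (i - 1)) ys"

definition lieC :: "letter ser set" where "lieC = lie_compl {Cgen i | i. 1 \<le> i}"

definition ydeg :: "letter list \<Rightarrow> nat" where "ydeg w = length (filter (\<lambda>a. a = Y) w)"

definition bihom :: "nat \<Rightarrow> nat \<Rightarrow> letter ser \<Rightarrow> bool" where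
  "bihom n r f = (\<forall>w. f w \<noteq> 0 \<longrightarrow> length w = n \<and> ydeg w = r)"

definition bipart :: "nat \<Rightarrow> nat \<Rightarrow> letter ser \<Rightarrow> letter ser" where
  "bipart n r f = (\<lambda>w. if length w = n \<and> ydeg w = r then f w else 0)"

text \<open>Continuous derivation D of Ass_2 with D(x) = dx, D(y) = dy (dx, dy without constant term).\<close>
definition dder :: "letter ser \<Rightarrow> letter ser \<Rightarrow> letter ser \<Rightarrow> letter ser" where
  "dder dx dy g = (\<lambda>u. \<Sum>i\<in>{0..length u}. \<Sum>j\<in>{i..length u}.
      g (take i u @ [X] @ drop j u) * dx (drop i (take j u))
    + g (take i u @ [Y] @ drop j u) * dy (drop i (take j u)))"

definition dpois :: "letter ser \<Rightarrow> letter ser \<Rightarrow> letter ser" where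
  "dpois f g = dder szero (sbr ys f) g"

definition pb :: "letter ser \<Rightarrow> letter ser \<Rightarrow> letter ser" where
  "pb f g = ssub (sadd (sbr f g) (dpois f g)) (dpois g f)"

section \<open>The substitution f(x,y) |-> f(-x-y,-y)\<close>

fun subst_coef :: "letter \<Rightarrow> letter \<Rightarrow> rat" where
  "subst_coef X _ = -1"
| "subst_coef Y Y = -1"
| "subst_coef Y X = 0"

definition subst_neg :: "letter ser \<Rightarrow> letter ser" where
  "subst_neg f = (\<lambda>u. \<Sum>w\<in>{w. length w = length u}.
      f w * (\<Prod>i<length u. subst_coef (w ! i) (u ! i)))"

text \<open>Words in y_i (letters i >= 1) are nat lists; y_{i1}...y_{ir} corresponds to
  x^(i1-1) y ... x^(ir-1) y.\<close>
fun decode :: "nat list \<Rightarrow> letter list" where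
  "decode [] = []"
| "decode (i # v) = replicate (i - 1) X @ Y # decode v"

text \<open>pi_y(f): f_y y rewritten in the y_i.\<close>
definition piy :: "letter ser \<Rightarrow> nat ser" where
  "piy f = (\<lambda>v. if v = [] \<or> 0 \<in> set v then 0 else f (decode v))"

definition fstar :: "letter ser \<Rightarrow> nat ser" where
  "fstar f = (\<lambda>v. piy f v +
     (if 2 \<le> length v \<and> (\<forall>i\<in>set v. i = 1)
      then (-1) ^ (length v - 1) / of_nat (length v) * f (replicate (length v - 1) X @ [Y])
      else 0))"

definition consume :: "nat \<Rightarrow> nat list \<Rightarrow> nat list option" where
  "consume j u = (if j = 0 then Some u else
     (case u of [] \<Rightarrow> None | a # u' \<Rightarrow> if a = j then Some u' else None))"

text \<open>Coefficient of u \<otimes> v in Delta_*(w), where Delta_*(y_i) = sum_{j+k=i} y_j \<otimes> y_k, y_0 = 1.\<close>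
fun dcoef :: "nat list \<Rightarrow> nat list \<Rightarrow> nat list \<Rightarrow> nat" where
  "dcoef [] u v = (if u = [] \<and> v = [] then 1 else 0)"
| "dcoef (i # w) u v = (\<Sum>j\<in>{0..i}.
     (case (consume j u, consume (i - j) v) of
        (Some u', Some v') \<Rightarrow> dcoef w u' v'
      | _ \<Rightarrow> 0))"

text \<open>Coefficient of u \<otimes> v in Delta_*(F), for F supported on words with letters >= 1
  (the index set contains every such w with nonzero dcoef w u v).\<close>
definition cop :: "nat ser \<Rightarrow> nat list \<Rightarrow> nat list \<Rightarrow> rat" where
  "cop F u v = (\<Sum>w\<in>{w. length w \<le> length u + length v \<and>
                        set w \<subseteq> {1..sum_list u + sum_list v}}.
                 F w * of_nat (dcoef w u v))"

definition primitive :: "nat ser \<Rightarrow> bool" where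
  "primitive F = (\<forall>u v. cop F u v =
      (if v = [] then F u else 0) + (if u = [] then F v else 0))"

definition ds :: "letter ser set" where
  "ds = {f. f \<in> lie2 \<and> (\<forall>w. length w < 3 \<longrightarrow> f w = 0) \<and> primitive (fstar f)}"

definition ygens :: "nat ser set" where "ygens = {mono [i] | i. 1 \<le> i}"

definition ls_part :: "nat \<Rightarrow> nat \<Rightarrow> letter ser set" where
  "ls_part n r = {f. bihom n r f \<and>
     (f = szero \<or> (3 \<le> n \<and> f \<in> lie2 \<and> piy f \<in> lie_gen ygens \<and> (r = 1 \<longrightarrow> odd n)))}"

definition LS :: "letter ser set" where
  "LS = {f. finite {(n, r). bipart n r f \<noteq> szero} \<and> (\<forall>n r. bipart n r f \<in> ls_part n r)}"

fun blocks :: "letter list \<Rightarrow> nat list" where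
  "blocks [] = [0]"
| "blocks (X # w) = (let bs = blocks w in Suc (hd bs) # tl bs)"
| "blocks (Y # w) = 0 # blocks w"

fun unblocks :: "nat list \<Rightarrow> letter list" where
  "unblocks [] = []"
| "unblocks [a] = replicate a X"
| "unblocks (a # as) = replicate a X @ Y # unblocks as"

text \<open>push(x^a0 y x^a1 ... y x^ar) = x^ar y x^a0 y ... y x^a(r-1); its inverse on words:\<close>
definition unpush_word :: "letter list \<Rightarrow> letter list" where
  "unpush_word u = unblocks (rotate1 (blocks u))"

text \<open>Linear extension of push: coefficient of u in push(f) is the coefficient of push^{-1}(u) in f.\<close>
definition push :: "letter ser \<Rightarrow> letter ser" where
  "push f = (\<lambda>u. f (unpush_word u))"

definition push_neutral :: "nat \<Rightarrow> letter ser \<Rightarrow> bool" where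
  "push_neutral s p = ((\<lambda>u. \<Sum>i\<le>s. (push ^^ i) p u) = szero)"

definition yder :: "letter ser \<Rightarrow> letter ser" where
  "yder b = (\<lambda>w. b (Y # w))"

definition lkv_part :: "nat \<Rightarrow> nat \<Rightarrow> letter ser set" where
  "lkv_part n r = {b. bihom n r b \<and> (b \<noteq> szero \<longrightarrow> 3 \<le> n) \<and> b \<in> lieC \<and> push b = b \<and>
     (2 \<le> r \<longrightarrow> push_neutral (r - 1) (yder b))}"

end

theory Submission
  imports Defs
begin

text \<open>
  Since the lowest-depth part of \<open>f(-x-y, -y)\<close> is that of \<open>f(-x, -y)\<close>, the morphism is multiplication
  by \<open>(-1)^n\<close> in weight \<open>n\<close>, and the content is the comparison of the defining conditions. Encode
  \<open>f\<close> of depth \<open>r\<close> by the polynomial \<open>P(z_0, \<dots>, z_r)\<close> in which \<open>x^{a_0} y \<dots> y x^{a_r}\<close> becomes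
  \<open>z_0^{a_0} \<dots> z_r^{a_r}\<close>. It is translation invariant for \<open>f\<close> in the Lie algebra of the \<open>C_i\<close>.
  The antipode relations of \<open>f\<close> (reversal of all \<open>z_i\<close>) and of \<open>f_y y\<close> (reversal of all but one \<open>z_i\<close>)
  compose to push-invariance up to the sign \<open>(-1)^(n-r)\<close>, and if this sign is negative the shuffle
  relations in the differences of the \<open>z_i\<close> force \<open>f = 0\<close>. Push-neutrality of \<open>f^y\<close> is then the vanishing
  of the cyclic trace of the Lie polynomial \<open>f_y y\<close>. Conversely, in depth at most 3, push-neutrality
  and reversal give all the shuffle relations of \<open>f_y y\<close>, which is therefore Lie by Dynkin's formula.
\<close>

section \<open>Series\<close>

lemma smult_Nil: "smult f g [] = f [] * g []"
  by (simp add: smult_def)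

text \<open>The empty prefix is split off; in the rest the letter \<open>a\<close> moves into
  \<open>f\<close>, so identities for products follow by induction on the word.\<close>

lemma smult_Cons: "smult f g (a # w) = f [] * g (a # w) + smult (\<lambda>v. f (a # v)) g w"
proof -
  have "{0..length (a # w)} = insert 0 (Suc ` {0..length w})"
    by (auto simp: image_Suc_atLeastAtMost)
  then have "smult f g (a # w) = f [] * g (a # w)
      + (\<Sum>i\<in>Suc ` {0..length w}. f (take i (a # w)) * g (drop i (a # w)))"
    by (simp add: smult_def)
  also have "\<dots> = f [] * g (a # w) + smult (\<lambda>v. f (a # v)) g w"
    by (subst sum.reindex) (auto simp: smult_def)
  finally show ?thesis .
qed

lemma smult_add_left: "smult (\<lambda>v. f v + g v) h w = smult f h w + smult g h w"
  by (simp add: smult_def sum.distrib algebra_simps)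
lemma smult_add_right: "smult h (\<lambda>v. f v + g v) w = smult h f w + smult h g w"
  by (simp add: smult_def sum.distrib algebra_simps)
lemma smult_diff_left: "smult (\<lambda>v. f v - g v) h w = smult f h w - smult g h w"
  by (simp add: smult_def sum_subtractf algebra_simps)
lemma smult_diff_right: "smult h (\<lambda>v. f v - g v) w = smult h f w - smult h g w"
  by (simp add: smult_def sum_subtractf algebra_simps)
lemma smult_scale_left: "smult (\<lambda>v. c * f v) h w = c * smult f h w"
  by (simp add: smult_def sum_distrib_left algebra_simps)
lemma smult_scale_right: "smult h (\<lambda>v. c * f v) w = c * smult h f w"
  by (simp add: smult_def sum_distrib_left algebra_simps)

lemma smult_minus: "smult (\<lambda>v. - f v) (\<lambda>v. - g v) w = smult f g w"
  by (simp add: smult_def)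
lemma smult_zero_left: "smult (\<lambda>v. 0) h w = 0"
  by (simp add: smult_def)

lemma smult_assoc: "smult (smult f g) h w = smult f (smult g h) w"
  by (induction w arbitrary: f g h)
    (simp_all add: smult_Nil smult_Cons smult_add_left smult_scale_left algebra_simps)

lemma smult_assoc_fun: "smult (smult f g) h = smult f (smult g h)"
  using smult_assoc by blast

lemmas ser_defs = szero_def sadd_def ssub_def sscale_def sbr_def
lemmas smult_linear = smult_add_left smult_add_right smult_diff_left smult_diff_right
  smult_scale_left smult_scale_right

lemma sbr_Jacobi: "sbr f (sbr g h) = sadd (sbr (sbr f g) h) (sbr g (sbr f h))"
  by (simp add: ser_defs smult_linear smult_assoc_fun fun_eq_iff)

lemma mono_append: "smult (mono u) (mono v) = mono (u @ v)"
proof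
  fix w
  have e: "mono (a # u) [] = 0" "(\<lambda>v. mono (a # u) (b # v)) = (\<lambda>v. (if a = b then 1 else 0) * mono u v)"
    for a b :: 'a and u by (auto simp: mono_def)
  show "smult (mono u) (mono v) w = mono (u @ v) w"
  proof (induction u arbitrary: w)
    case Nil
    then show ?case by (cases w) (auto simp: smult_Nil smult_Cons smult_zero_left mono_def)
  next
    case (Cons a u)
    show ?case
    proof (cases w)
      case (Cons b w')
      then show ?thesis
        by (simp only: smult_Cons e smult_scale_left Cons.IH) (auto simp: mono_def)
    qed (simp add: smult_Nil e)
  qed
qed

lemma smult_const:
  "smult h (\<lambda>v. if v = [] then c else 0) w = c * h w" (is ?r)
  "smult (\<lambda>v. if v = [] then c else 0) h w = c * h w" (is ?l)
proof -
  show ?r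
    by (induction w arbitrary: h) (auto simp: smult_Nil smult_Cons)
  show ?l
    by (cases w) (auto simp: smult_Nil smult_Cons smult_zero_left)
qed

lemma lie_gen_sum:
  assumes "finite S" "\<And>s. s \<in> S \<Longrightarrow> h s \<in> lie_gen G"
  shows "(\<lambda>w. \<Sum>s\<in>S. h s w) \<in> lie_gen G"
  using assms
proof (induction S rule: finite_induct)
  case empty
  then show ?case using lie_gen.zero[of G] by (simp add: szero_def)
next
  case (insert s S)
  then have "sadd (h s) (\<lambda>w. \<Sum>s\<in>S. h s w) \<in> lie_gen G"
    by (intro lie_gen.add) auto
  with insert show ?case by (simp add: sadd_def)
qed

lemma lie_gen_subset:
  assumes "G \<subseteq> lie_gen H" shows "lie_gen G \<subseteq> lie_gen H"
proof
  fix f assume "f \<in> lie_gen G"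
  then show "f \<in> lie_gen H"
    by induction (use assms in \<open>auto intro: lie_gen.intros\<close>)
qed

section \<open>Lie polynomials in linear series\<close>

text \<open>Degree-one series over any alphabet, with no finiteness of support: this covers x and y,
  the letters y_i and, later, functions on lists of rationals.\<close>

definition linear_ser :: "'a ser set" where
  "linear_ser = {F. \<forall>w. length w \<noteq> 1 \<longrightarrow> F w = 0}"

lemma lie_linear_Nil: "f \<in> lie_gen linear_ser \<Longrightarrow> f [] = 0"
  by (induction rule: lie_gen.induct) (auto simp: linear_ser_def ser_defs smult_Nil)

lemma smult_rev: "smult f g (rev w) = smult (\<lambda>v. g (rev v)) (\<lambda>v. f (rev v)) w"
proof -
  have "smult f g (rev w) = (\<Sum>i\<in>{0..length w}. f (rev (drop (length w - i) w)) * g (rev (take (length w - i) w)))"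
    by (simp add: smult_def take_rev drop_rev)
  also have "\<dots> = (\<Sum>i\<in>{0..length w}. f (rev (drop i w)) * g (rev (take i w)))"
    by (rule sum.reindex_bij_witness[where i="\<lambda>i. length w - i" and j="\<lambda>i. length w - i"]) auto
  finally show ?thesis by (simp add: smult_def mult.commute)
qed

lemma smult_sign: "smult (\<lambda>v. (-1) ^ length v * f v) (\<lambda>v. (-1) ^ length v * g v) w
    = (-1) ^ length w * smult f g w"
proof -
  have e: "(-1::rat) ^ i * (-1) ^ (length w - i) = (-1) ^ length w" if "i \<le> length w" for i
    using that by (simp flip: power_add)
  have "smult (\<lambda>v. (-1) ^ length v * f v) (\<lambda>v. (-1) ^ length v * g v) w
    = (\<Sum>i\<in>{0..length w}. ((-1) ^ i * (-1) ^ (length w - i)) * (f (take i w) * g (drop i w)))"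
    unfolding smult_def by (intro sum.cong) (auto simp: min_def mult_ac)
  also have "\<dots> = (\<Sum>i\<in>{0..length w}. (-1) ^ length w * (f (take i w) * g (drop i w)))"
    by (intro sum.cong) (auto simp: e)
  finally show ?thesis by (simp add: smult_def sum_distrib_left)
qed

text \<open>The antipode, i.e. reversal with sign (-1)^length, is an antiautomorphism that is -1 in
  degree one. The elements on which such a map is -1 are closed under brackets.\<close>

lemma lie_linear_rev:
  assumes "f \<in> lie_gen linear_ser"
  shows "f (rev w) = - ((-1) ^ length w * f w)"
  using assms
proof (induction arbitrary: w)
  case (br f g)
  have "smult f g (rev w) = (-1) ^ length w * smult g f w"
       "smult g f (rev w) = (-1) ^ length w * smult f g w"
    by (simp_all add: smult_rev br.IH smult_minus smult_sign)
  then show ?case by (simp add: ser_defs algebra_simps)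
next
  case (gen g)
  then show ?case by (cases "length w = 1") (auto simp: linear_ser_def length_Suc_conv)
qed (auto simp: ser_defs algebra_simps)

lemma sum_shift_periodic:
  fixes k :: "nat \<Rightarrow> rat"
  assumes "\<And>i. k (i + n) = k i"
  shows "(\<Sum>i<n. k (i + j)) = (\<Sum>i<n. k i)"
proof (induction j)
  case (Suc j)
  have "(\<Sum>i<n. k (Suc i + j)) + k j = (\<Sum>i<Suc n. k (i + j))"
    by (subst sum.lessThan_Suc_shift) simp
  also have "\<dots> = (\<Sum>i<n. k (i + j)) + k j"
    using assms[of j] by (simp add: add.commute)
  finally show ?case using Suc by simp
qed simp

lemma rotate_add_length: "rotate (i + length w) w = rotate i w"
  by (metis mod_add_self2 rotate_conv_mod)

text \<open>The trace property tr(fg) = tr(gf): cutting the i-th rotation at j yields the same two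
  pieces, exchanged, as cutting the (i+j)-th rotation at n - j.\<close>

lemma cyclic_sum_smult:
  "(\<Sum>i<length w. smult f g (rotate i w)) = (\<Sum>i<length w. smult g f (rotate i w))"
proof -
  let ?n = "length w"
  have td: "take j (rotate i w) = drop (?n - j) (rotate (i + j) w)"
           "drop j (rotate i w) = take (?n - j) (rotate (i + j) w)" if "j \<le> ?n" for i j
  proof -
    have "rotate (i + j) w = rotate j (rotate i w)"
      by (simp add: rotate_rotate add.commute)
    also have "\<dots> = drop j (rotate i w) @ take j (rotate i w)"
      using that by (cases "j = ?n") (auto simp: rotate_id, simp add: rotate_drop_take)
    finally have e: "rotate (i + j) w = drop j (rotate i w) @ take j (rotate i w)" .
    show "take j (rotate i w) = drop (?n - j) (rotate (i + j) w)"
         "drop j (rotate i w) = take (?n - j) (rotate (i + j) w)"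
      by (simp_all add: e)
  qed
  have "(\<Sum>i<?n. smult f g (rotate i w))
      = (\<Sum>j\<in>{0..?n}. \<Sum>i<?n. f (take j (rotate i w)) * g (drop j (rotate i w)))"
    by (simp add: smult_def) (rule sum.swap)
  also have "\<dots> = (\<Sum>j\<in>{0..?n}. \<Sum>i<?n. g (take (?n - j) (rotate (i + j) w)) * f (drop (?n - j) (rotate (i + j) w)))"
  proof (intro sum.cong refl)
    fix j i assume "j \<in> {0..?n}"
    then have j: "j \<le> ?n" by simp
    show "f (take j (rotate i w)) * g (drop j (rotate i w))
        = g (take (?n - j) (rotate (i + j) w)) * f (drop (?n - j) (rotate (i + j) w))"
      by (simp only: td[OF j, of i] mult.commute)
  qed
  also have "\<dots> = (\<Sum>j\<in>{0..?n}. \<Sum>i<?n. g (take (?n - j) (rotate i w)) * f (drop (?n - j) (rotate i w)))"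
  proof (rule sum.cong[OF refl])
    fix j
    show "(\<Sum>i<?n. g (take (?n - j) (rotate (i + j) w)) * f (drop (?n - j) (rotate (i + j) w)))
        = (\<Sum>i<?n. g (take (?n - j) (rotate i w)) * f (drop (?n - j) (rotate i w)))"
      by (rule sum_shift_periodic[where k="\<lambda>i. g (take (?n - j) (rotate i w)) * f (drop (?n - j) (rotate i w))"])
        (simp add: rotate_add_length)
  qed
  also have "\<dots> = (\<Sum>j\<in>{0..?n}. \<Sum>i<?n. g (take j (rotate i w)) * f (drop j (rotate i w)))"
    by (rule sum.reindex_bij_witness[where i="\<lambda>i. ?n - i" and j="\<lambda>i. ?n - i"]) auto
  also have "\<dots> = (\<Sum>i<?n. smult g f (rotate i w))"
    by (simp add: smult_def) (rule sum.swap)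
  finally show ?thesis .
qed

text \<open>The cyclic trace kills brackets, and generators have no words of length at least
  2.\<close>

lemma lie_linear_cyclic_sum:
  assumes "f \<in> lie_gen linear_ser" "2 \<le> length w"
  shows "(\<Sum>i<length w. f (rotate i w)) = 0"
  using assms(1)
proof induction
  case (gen g)
  with assms(2) show ?case by (simp add: linear_ser_def)
next
  case (br f g)
  show ?case by (simp add: ser_defs sum_subtractf cyclic_sum_smult[of f g])
next
  case (scale f c)
  then show ?case by (simp add: sscale_def flip: sum_distrib_left)
qed (simp_all add: szero_def sadd_def sum.distrib)

text \<open>The pairing of \<open>f\<close> with the shuffle product of the single letter
  \<open>a\<close> and a word.\<close>

fun insert_sum :: "'a \<Rightarrow> 'a ser \<Rightarrow> 'a ser" where
  "insert_sum a f [] = f [a]"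
| "insert_sum a f (b # w) = f (a # b # w) + insert_sum a (\<lambda>v. f (b # v)) w"

lemma insert_sum_add: "insert_sum a (\<lambda>v. f v + g v) w = insert_sum a f w + insert_sum a g w"
  by (induction w arbitrary: f g) simp_all
lemma insert_sum_diff: "insert_sum a (\<lambda>v. f v - g v) w = insert_sum a f w - insert_sum a g w"
  by (induction w arbitrary: f g) simp_all
lemma insert_sum_scale: "insert_sum a (\<lambda>v. c * f v) w = c * insert_sum a f w"
  by (induction w arbitrary: f) (simp_all add: algebra_simps)

lemma insert_sum_snoc:
  "insert_sum a f (w @ [b]) = insert_sum a (\<lambda>v. f (v @ [b])) w + f (w @ [b, a])"
  by (induction w arbitrary: f) simp_all

text \<open>The inserted letter falls either left or right of the cut, so inserting is a derivation
  of the concatenation product.\<close>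

lemma insert_sum_smult:
  "insert_sum a (smult f g) w = smult (insert_sum a f) g w + smult f (insert_sum a g) w"
  by (induction w arbitrary: f g)
    (simp_all add: smult_Nil smult_Cons insert_sum_add insert_sum_scale smult_linear algebra_simps)

text \<open>All insertions have the same letter sum. This allows comparisons that hold only for a
  prescribed sum, as for cyclic words of total 0.\<close>

lemma insert_sum_cong:
  assumes "\<And>v. sum_list v = a + sum_list w \<Longrightarrow> f v = g v"
  shows "insert_sum a f w = insert_sum (a :: rat) g w"
  using assms
proof (induction w arbitrary: f g)
  case Nil
  then show ?case by simp
next
  case (Cons b w)
  have "insert_sum a (\<lambda>v. f (b # v)) w = insert_sum a (\<lambda>v. g (b # v)) w"
    by (rule Cons.IH, rule Cons.prems) simp
  moreover have "f (a # b # w) = g (a # b # w)"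
    by (rule Cons.prems) simp
  ultimately show ?case by simp
qed

text \<open>For a bracket, the derivation rule leaves commutators with the scalars
  \<open>f [a]\<close> and \<open>g [a]\<close>, and these cancel.\<close>

lemma insert_sum_linear:
  assumes "f \<in> lie_gen linear_ser"
  shows "insert_sum a f w = (if w = [] then f [a] else 0)"
  using assms
proof (induction arbitrary: w)
  case (gen g)
  have "insert_sum a h w = 0" if "\<And>v. v \<noteq> [] \<Longrightarrow> h v = 0" for h w
    using that by (induction w arbitrary: h) simp_all
  note * = this
  have "insert_sum a (\<lambda>v. g (b # v)) w' = 0" if "w = b # w'" for b w'
    using gen by (intro *) (auto simp: linear_ser_def)
  with gen show ?case by (cases w) (auto simp: linear_ser_def)
next
  case (br f g)
  have "insert_sum a f = (\<lambda>v. if v = [] then f [a] else 0)"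
       "insert_sum a g = (\<lambda>v. if v = [] then g [a] else 0)"
    using br.IH by auto
  moreover have "f [] = 0" "g [] = 0"
    using br.hyps lie_linear_Nil by auto
  ultimately show ?case
    by (simp add: ser_defs insert_sum_diff insert_sum_smult smult_const smult_Cons smult_Nil)
next
  case zero
  show ?case by (induction w) (simp_all add: ser_defs)
qed (auto simp: ser_defs insert_sum_add insert_sum_scale)

section \<open>Generating functions\<close>

text \<open>The monomial \<open>z_0^{a_0} \<dots> z_r^{a_r}\<close> attached to the word \<open>x^{a_0} y x^{a_1} \<dots> y x^{a_r}\<close>, with
  value 0 when the number of variables is not \<open>r + 1\<close>.\<close>

fun ev :: "letter list \<Rightarrow> rat list \<Rightarrow> rat" where
  "ev w [] = 0"
| "ev [] (z # zs) = (if zs = [] then 1 else 0)"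
| "ev (X # w) (z # zs) = z * ev w (z # zs)"
| "ev (Y # w) (z # zs) = ev w zs"

text \<open>The x-powers on both sides of the seam merge, so the variable z_i at the seam is shared
  by both factors. Wrong numbers of variables give 0, hence at most one summand survives.\<close>

lemma ev_append:
  "ev (u @ v) z = (\<Sum>i<length z. ev u (take (Suc i) z) * ev v (drop i z))"
proof (induction u z rule: ev.induct)
  case (2 z zs)
  have "(\<Sum>i<length zs. ev [] (take (Suc (Suc i)) (z # zs)) * ev v (drop i zs)) = 0"
    by (intro sum.neutral) auto
  then show ?case by (simp add: sum.lessThan_Suc_shift del: sum.lessThan_Suc)
next
  case (3 w z zs)
  then show ?case by (simp add: sum_distrib_left mult.assoc del: sum.lessThan_Suc)
next
  case (4 w z zs)
  then show ?case by (simp add: sum.lessThan_Suc_shift del: sum.lessThan_Suc)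
qed simp

text \<open>For infinite support the sum is 0 by convention; the algebraic rules below therefore
  assume \<open>finsupp\<close>.\<close>

definition gf :: "letter ser \<Rightarrow> rat list \<Rightarrow> rat" where
  "gf f z = (\<Sum>w | f w \<noteq> 0. f w * ev w z)"

definition finsupp :: "'a ser \<Rightarrow> bool" where
  "finsupp f \<longleftrightarrow> finite {w. f w \<noteq> 0}"

lemma gf_superset:
  assumes "finite S" "{w. f w \<noteq> 0} \<subseteq> S"
  shows "gf f z = (\<Sum>w\<in>S. f w * ev w z)"
  unfolding gf_def using assms by (intro sum.mono_neutral_left) auto

lemma finsupp_add: "finsupp f \<Longrightarrow> finsupp g \<Longrightarrow> finsupp (sadd f g)"
  unfolding finsupp_def by (rule finite_subset[of _ "{w. f w \<noteq> 0} \<union> {w. g w \<noteq> 0}"]) (auto simp: ser_defs)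
lemma finsupp_sub: "finsupp f \<Longrightarrow> finsupp g \<Longrightarrow> finsupp (ssub f g)"
  unfolding finsupp_def by (rule finite_subset[of _ "{w. f w \<noteq> 0} \<union> {w. g w \<noteq> 0}"]) (auto simp: ser_defs)
lemma finsupp_scale: "finsupp f \<Longrightarrow> finsupp (sscale c f)"
  unfolding finsupp_def by (rule finite_subset[of _ "{w. f w \<noteq> 0}"]) (auto simp: ser_defs)

lemma gf_add: "finsupp f \<Longrightarrow> finsupp g \<Longrightarrow> gf (sadd f g) z = gf f z + gf g z"
  unfolding finsupp_def
  by (subst (1 2 3) gf_superset[of "{w. f w \<noteq> 0} \<union> {w. g w \<noteq> 0}"])
    (auto simp: ser_defs sum.distrib algebra_simps)
lemma gf_sub: "finsupp f \<Longrightarrow> finsupp g \<Longrightarrow> gf (ssub f g) z = gf f z - gf g z"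
  unfolding finsupp_def
  by (subst (1 2 3) gf_superset[of "{w. f w \<noteq> 0} \<union> {w. g w \<noteq> 0}"])
    (auto simp: ser_defs sum_subtractf algebra_simps)
lemma gf_scale: "finsupp f \<Longrightarrow> gf (sscale c f) z = c * gf f z"
  unfolding finsupp_def
  by (subst (1 2) gf_superset[of "{w. f w \<noteq> 0}"])
    (auto simp: ser_defs sum_distrib_left algebra_simps)

lemma smult_support:
  "smult f g w \<noteq> 0 \<Longrightarrow> \<exists>u v. w = u @ v \<and> f u \<noteq> 0 \<and> g v \<noteq> 0"
  unfolding smult_def by (metis (no_types, lifting) append_take_drop_id mult_eq_0_iff sum.neutral)

lemma finsupp_smult: "finsupp f \<Longrightarrow> finsupp g \<Longrightarrow> finsupp (smult f g)"
  unfolding finsupp_def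
  by (rule finite_subset[of _ "(\<lambda>(u, v). u @ v) ` ({w. f w \<noteq> 0} \<times> {w. g w \<noteq> 0})"])
    (auto dest: smult_support)

lemma sum_smult:
  assumes f: "finsupp f" and g: "finsupp g"
  shows "(\<Sum>w | smult f g w \<noteq> 0. smult f g w * h w)
    = (\<Sum>u | f u \<noteq> 0. \<Sum>v | g v \<noteq> 0. f u * g v * h (u @ v))"
proof -
  let ?F = "{w. f w \<noteq> 0}" and ?G = "{w. g w \<noteq> 0}"
  let ?S = "(\<lambda>(u, v). u @ v) ` (?F \<times> ?G)"
  have fin: "finite ?F" "finite ?G" "finite ?S"
    using f g by (auto simp: finsupp_def)
  \<comment> \<open>Cut positions of \<open>w\<close> correspond to pairs of words with
    concatenation \<open>w\<close>; grouping all pairs by their concatenation then gives the double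
    sum.\<close>
  have sm: "smult f g w = (\<Sum>p\<in>{p\<in>?F \<times> ?G. (\<lambda>(u, v). u @ v) p = w}. f (fst p) * g (snd p))" for w
  proof -
    have "smult f g w = (\<Sum>i\<in>{i\<in>{0..length w}. (take i w, drop i w) \<in> ?F \<times> ?G}. f (take i w) * g (drop i w))"
      unfolding smult_def by (rule sum.mono_neutral_right) auto
    also have "\<dots> = (\<Sum>p\<in>{p\<in>?F \<times> ?G. (\<lambda>(u, v). u @ v) p = w}. f (fst p) * g (snd p))"
      by (rule sum.reindex_bij_witness[where i="\<lambda>p. length (fst p)" and j="\<lambda>i. (take i w, drop i w)"]) auto
    finally show ?thesis .
  qed
  have "(\<Sum>w | smult f g w \<noteq> 0. smult f g w * h w) = (\<Sum>w\<in>?S. smult f g w * h w)"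
    using fin by (intro sum.mono_neutral_left) (auto dest!: smult_support)
  also have "\<dots> = (\<Sum>w\<in>?S. \<Sum>p\<in>{p\<in>?F \<times> ?G. (\<lambda>(u, v). u @ v) p = w}. f (fst p) * g (snd p) * h (fst p @ snd p))"
    unfolding sm sum_distrib_right by (intro sum.cong) auto
  also have "\<dots> = (\<Sum>p\<in>?F \<times> ?G. f (fst p) * g (snd p) * h (fst p @ snd p))"
    using fin by (intro sum.image_gen[symmetric]) auto
  also have "\<dots> = (\<Sum>u\<in>?F. \<Sum>v\<in>?G. f u * g v * h (u @ v))"
    by (simp add: sum.cartesian_product case_prod_unfold)
  finally show ?thesis .
qed

lemma gf_smult:
  assumes "finsupp f" "finsupp g"
  shows "gf (smult f g) z = (\<Sum>i<length z. gf f (take (Suc i) z) * gf g (drop i z))"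
proof -
  let ?F = "{w. f w \<noteq> 0}" and ?G = "{w. g w \<noteq> 0}"
  have "gf (smult f g) z = (\<Sum>u\<in>?F. \<Sum>v\<in>?G. \<Sum>i<length z. f u * g v * (ev u (take (Suc i) z) * ev v (drop i z)))"
    unfolding gf_def sum_smult[OF assms] ev_append sum_distrib_left ..
  also have "\<dots> = (\<Sum>u\<in>?F. \<Sum>i<length z. \<Sum>v\<in>?G. f u * g v * (ev u (take (Suc i) z) * ev v (drop i z)))"
    by (intro sum.cong refl sum.swap)
  also have "\<dots> = (\<Sum>i<length z. \<Sum>u\<in>?F. \<Sum>v\<in>?G. f u * g v * (ev u (take (Suc i) z) * ev v (drop i z)))"
    by (rule sum.swap)
  also have "\<dots> = (\<Sum>i<length z. gf f (take (Suc i) z) * gf g (drop i z))"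
    unfolding gf_def sum_product by (intro sum.cong refl) (simp add: mult_ac)
  finally show ?thesis .
qed

section \<open>The Lie algebra generated by the \<open>C\<^sub>i\<close>\<close>

definition Cgens :: "letter ser set" where "Cgens = {Cgen i | i. 1 \<le> i}"

lemma Cgen_1: "Cgen (Suc 0) = ys"
  by (simp add: Cgen_def)
lemma Cgen_Suc: "Cgen (Suc (Suc i)) = sbr xs (Cgen (Suc i))"
  by (simp add: Cgen_def)

lemma Cgens_induct [consumes 1, case_names y br]:
  assumes "g \<in> Cgens" "P ys" "\<And>g. g \<in> Cgens \<Longrightarrow> P g \<Longrightarrow> P (sbr xs g)"
  shows "P g"
proof -
  obtain i where "1 \<le> i" "g = Cgen i" using assms(1) by (auto simp: Cgens_def)
  then obtain j where g: "g = Cgen (Suc j)" by (cases i) auto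
  have "P (Cgen (Suc j))"
    by (induction j) (use assms(2,3) in \<open>auto simp: Cgen_1 Cgen_Suc Cgens_def\<close>)
  with g show ?thesis by simp
qed

lemma ys_Cgens: "ys \<in> Cgens"
  using Cgen_1 by (force simp: Cgens_def)

lemma sbr_xs_Cgens: "g \<in> Cgens \<Longrightarrow> sbr xs g \<in> Cgens"
proof -
  assume "g \<in> Cgens"
  then obtain i where "1 \<le> i" "g = Cgen i" by (auto simp: Cgens_def)
  then obtain j where "g = Cgen (Suc j)" by (cases i) auto
  then have "sbr xs g = Cgen (Suc (Suc j))" by (simp add: Cgen_Suc)
  then show ?thesis by (auto simp: Cgens_def)
qed

text \<open>ad(x) is a derivation by the Jacobi identity and shifts C_i to C_(i+1).\<close>

lemma lie_Cgens_sbr_xs: "f \<in> lie_gen Cgens \<Longrightarrow> sbr xs f \<in> lie_gen Cgens"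
proof (induction rule: lie_gen.induct)
  case (br f g)
  then show ?case unfolding sbr_Jacobi[of xs f g] by (simp add: lie_gen.add lie_gen.br)
next
  case (scale f c)
  have "sbr xs (sscale c f) = sscale c (sbr xs f)"
    by (simp add: ser_defs smult_linear algebra_simps)
  with scale show ?case by (auto intro: lie_gen.intros)
next
  case (add f g)
  have "sbr xs (sadd f g) = sadd (sbr xs f) (sbr xs g)"
    by (simp add: ser_defs smult_linear algebra_simps)
  with add show ?case by (auto intro: lie_gen.intros)
next
  case zero
  have "sbr xs szero = szero"
    by (simp add: ser_defs smult_def)
  then show ?case by (auto intro: lie_gen.intros)
qed (auto intro: lie_gen.gen sbr_xs_Cgens)

lemma ydeg_append: "ydeg (u @ v) = ydeg u + ydeg v"
  by (simp add: ydeg_def)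

lemma lie_Cgens_ydeg_0: "f \<in> lie_gen Cgens \<Longrightarrow> ydeg w = 0 \<Longrightarrow> f w = 0"
proof (induction arbitrary: w rule: lie_gen.induct)
  case (gen g)
  then show ?case
  proof (induction arbitrary: w rule: Cgens_induct)
    case y
    then show ?case by (auto simp: ys_def mono_def ydeg_def)
  next
    case (br g)
    have "smult xs g w = 0" "smult g xs w = 0"
      using br by (auto dest!: smult_support simp: ydeg_append intro: ccontr)
    then show ?case by (simp add: ser_defs)
  qed
next
  case (br f g)
  have "smult f g w = 0" "smult g f w = 0"
    using br by (auto dest!: smult_support simp: ydeg_append intro: ccontr)
  then show ?case by (simp add: ser_defs)
qed (auto simp: ser_defs)

text \<open>Lazard elimination: brackets have no x-component, and those involving x stay in the Lie
  algebra of the C_i because it is stable under ad(x).\<close>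

lemma lie_xy_decompose:
  assumes "f \<in> lie_gen {xs, ys}"
  shows "\<exists>c. \<exists>g\<in>lie_gen Cgens. f = sadd (sscale c xs) g"
  using assms
proof induction
  case (gen g)
  have "xs = sadd (sscale 1 xs) szero" "ys = sadd (sscale 0 xs) ys"
    by (simp_all add: ser_defs)
  with gen show ?case
    using lie_gen.zero[of Cgens] lie_gen.gen[OF ys_Cgens] by (metis insertE singletonD)
next
  case zero
  have "szero = sadd (sscale 0 xs) szero" by (simp add: ser_defs)
  then show ?case using lie_gen.zero by blast
next
  case (add f g)
  then obtain c d u v where "u \<in> lie_gen Cgens" "v \<in> lie_gen Cgens"
    "f = sadd (sscale c xs) u" "g = sadd (sscale d xs) v" by blast
  moreover from this have "sadd f g = sadd (sscale (c + d) xs) (sadd u v)"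
    by (simp add: ser_defs algebra_simps)
  ultimately show ?case using lie_gen.add by blast
next
  case (scale f k)
  then obtain c u where "u \<in> lie_gen Cgens" "f = sadd (sscale c xs) u" by blast
  moreover from this have "sscale k f = sadd (sscale (k * c) xs) (sscale k u)"
    by (simp add: ser_defs algebra_simps)
  ultimately show ?case using lie_gen.scale by blast
next
  case (br f g)
  then obtain c d u v where uv: "u \<in> lie_gen Cgens" "v \<in> lie_gen Cgens"
    "f = sadd (sscale c xs) u" "g = sadd (sscale d xs) v" by blast
  let ?w = "sadd (sadd (sscale c (sbr xs v)) (sscale (- d) (sbr xs u))) (sbr u v)"
  have "sbr f g = sadd (sscale 0 xs) ?w"
    unfolding uv by (simp add: ser_defs smult_linear algebra_simps)
  moreover have "?w \<in> lie_gen Cgens"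
    using uv by (intro lie_Cgens_sbr_xs lie_gen.add lie_gen.scale lie_gen.br)
  ultimately show ?case by blast
qed

lemma gf_mono: "finsupp (mono w)" "gf (mono w) z = ev w z"
proof -
  have "{u. mono w u \<noteq> 0} = {w}" by (auto simp: mono_def)
  then show "finsupp (mono w)" "gf (mono w) z = ev w z"
    by (simp_all add: finsupp_def gf_def mono_def)
qed

lemma xs_gf: "finsupp xs" "gf xs z = (if length z = 1 then hd z else 0)"
  unfolding xs_def gf_mono by (cases z; auto simp: gf_mono)+

lemma ys_gf: "finsupp ys" "gf ys z = (if length z = 2 then 1 else 0)"
  unfolding ys_def gf_mono by (cases z; cases "tl z"; auto simp: gf_mono)+

lemma gf_Nil: "gf f [] = 0"
  by (simp add: gf_def)

text \<open>A factor x on the left raises the exponent of z_0, one on the right that of z_r.\<close>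

lemma sbr_xs_gf:
  assumes "finsupp f"
  shows "finsupp (sbr xs f)" "gf (sbr xs f) z = (hd z - last z) * gf f z"
proof -
  show "finsupp (sbr xs f)"
    using assms xs_gf by (auto simp: sbr_def intro: finsupp_sub finsupp_smult)
  have "gf (smult xs f) z = hd z * gf f z"
  proof (cases z)
    case (Cons a zs)
    have "(\<Sum>i<length zs. gf xs (a # take (Suc i) zs) * gf f (drop i zs)) = 0"
      by (intro sum.neutral) (auto simp: xs_gf)
    with Cons show ?thesis
      by (simp add: gf_smult xs_gf(1) assms sum.lessThan_Suc_shift del: sum.lessThan_Suc) (simp add: xs_gf(2))
  qed (simp add: gf_Nil)
  moreover have "gf (smult f xs) z = last z * gf f z"
  proof (cases z rule: rev_cases)
    case (snoc zs a)
    have "(\<Sum>i<length zs. gf f (take (Suc i) z) * gf xs (drop i z)) = 0"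
      using snoc by (intro sum.neutral) (auto simp: xs_gf)
    with snoc show ?thesis
      by (simp add: gf_smult xs_gf assms)
  qed (simp add: gf_Nil)
  ultimately show "gf (sbr xs f) z = (hd z - last z) * gf f z"
    using assms by (simp add: sbr_def gf_sub finsupp_smult xs_gf(1) algebra_simps)
qed

lemma Cgens_gf:
  assumes "g \<in> Cgens"
  shows "finsupp g" "\<exists>k. \<forall>z. gf g z = (if length z = 2 then (hd z - last z) ^ k else 0)"
  using assms
proof (induction rule: Cgens_induct)
  case y
  case 1 show ?case by (rule ys_gf)
  case 2 show ?case by (rule exI[of _ 0]) (simp add: ys_gf)
next
  case (br g)
  case 1 show ?case using br by (simp add: sbr_xs_gf)
  from br obtain k where "\<forall>z. gf g z = (if length z = 2 then (hd z - last z) ^ k else 0)" by blast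
  then show "\<exists>k. \<forall>z. gf (sbr xs g) z = (if length z = 2 then (hd z - last z) ^ k else 0)"
    using br by (intro exI[of _ "Suc k"]) (simp add: sbr_xs_gf)
qed

lemma lie_Cgens_finsupp: "f \<in> lie_gen Cgens \<Longrightarrow> finsupp f"
  by (induction rule: lie_gen.induct)
    (auto simp: Cgens_gf sbr_def finsupp_add finsupp_sub finsupp_scale finsupp_smult,
     simp add: finsupp_def szero_def)

text \<open>The generators give powers of z_0 - z_1, and the product formula commutes with a common
  shift of the variables.\<close>

lemma gf_translate:
  assumes "f \<in> lie_gen Cgens"
  shows "gf f (map ((+) c) z) = gf f z"
  using assms
proof (induction arbitrary: z)
  case (gen g)
  from Cgens_gf(2)[OF gen] obtain k where
    k: "\<And>z. gf g z = (if length z = 2 then (hd z - last z) ^ k else 0)" by blast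
  show ?case unfolding k by (cases z rule: list.exhaust) (auto simp: last_map)
next
  case (br f g)
  then have "finsupp f" "finsupp g" by (auto intro: lie_Cgens_finsupp)
  with br.IH show ?case
    by (simp add: sbr_def gf_sub gf_smult finsupp_smult take_map drop_map)
qed (auto simp: gf_add gf_scale lie_Cgens_finsupp, simp add: gf_def szero_def)

text \<open>In the differences \<open>u\<^sub>i = z\<^sub>i - z\<^sub>i\<^sub>-\<^sub>1\<close> of the variables, multiplication of series becomes the
  concatenation product of functions on words in rational numbers.\<close>

fun psums :: "rat \<Rightarrow> rat list \<Rightarrow> rat list" where
  "psums c [] = [c]"
| "psums c (u # us) = c # psums (c + u) us"

definition dgf :: "letter ser \<Rightarrow> rat ser" where
  "dgf f us = gf f (psums 0 us)"

lemma length_psums [simp]: "length (psums c us) = Suc (length us)"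
  by (induction us arbitrary: c) auto

lemma map_psums: "map ((+) d) (psums c us) = psums (d + c) us"
  by (induction us arbitrary: c) (auto simp: add.assoc)

lemma take_psums: "i \<le> length us \<Longrightarrow> take (Suc i) (psums c us) = psums c (take i us)"
  by (induction us arbitrary: c i) (auto simp: take_Cons split: nat.splits)

lemma drop_psums: "i \<le> length us \<Longrightarrow> drop i (psums c us) = psums (c + sum_list (take i us)) (drop i us)"
  by (induction us arbitrary: c i) (auto simp: take_Cons drop_Cons add.assoc split: nat.splits)

lemma gf_psums:
  assumes "f \<in> lie_gen Cgens"
  shows "gf f (psums c us) = dgf f us"
  using gf_translate[OF assms, of c "psums 0 us"] by (simp add: dgf_def map_psums)

text \<open>Sharing the seam variable means that the list of differences is cut cleanly in two. The
  second factor starts at a partial sum instead of 0, which translation invariance repairs.\<close>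

lemma dgf_smult:
  assumes "f \<in> lie_gen Cgens" "g \<in> lie_gen Cgens"
  shows "dgf (smult f g) = smult (dgf f) (dgf g)"
proof
  fix us
  have "dgf (smult f g) us = (\<Sum>i\<le>length us. gf f (take (Suc i) (psums 0 us)) * gf g (drop i (psums 0 us)))"
    using assms by (simp add: dgf_def gf_smult lie_Cgens_finsupp lessThan_Suc_atMost)
  also have "\<dots> = (\<Sum>i\<in>{0..length us}. dgf f (take i us) * dgf g (drop i us))"
    using assms by (intro sum.cong) (auto simp: take_psums drop_psums gf_psums)
  finally show "dgf (smult f g) us = smult (dgf f) (dgf g) us" by (simp add: smult_def)
qed

text \<open>This makes the shuffle relation \<open>insert_sum_linear\<close> available in the
  differences of the variables.\<close>

lemma dgf_lie:
  assumes "f \<in> lie_gen Cgens"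
  shows "dgf f \<in> lie_gen linear_ser"
  using assms
proof induction
  case (gen g)
  then have "dgf g \<in> linear_ser"
    using Cgens_gf(2)[OF gen] by (auto simp: linear_ser_def dgf_def)
  then show ?case by (rule lie_gen.gen)
next
  case zero
  have "dgf szero = szero" by (simp add: dgf_def gf_def szero_def fun_eq_iff)
  then show ?case by (simp add: lie_gen.zero)
next
  case (add f g)
  then have "dgf (sadd f g) = sadd (dgf f) (dgf g)"
    by (simp add: dgf_def gf_add lie_Cgens_finsupp fun_eq_iff) (simp add: sadd_def dgf_def)
  with add show ?case by (simp add: lie_gen.add)
next
  case (scale f c)
  then have "dgf (sscale c f) = sscale c (dgf f)"
    by (simp add: dgf_def gf_scale lie_Cgens_finsupp fun_eq_iff) (simp add: sscale_def dgf_def)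
  with scale show ?case by (simp add: lie_gen.scale)
next
  case (br f g)
  then have "dgf (sbr f g) us = dgf (smult f g) us - dgf (smult g f) us" for us
    by (simp add: dgf_def sbr_def gf_sub lie_Cgens_finsupp finsupp_smult)
  then have "dgf (sbr f g) = sbr (dgf f) (dgf g)"
    using br by (simp add: fun_eq_iff dgf_smult) (simp add: sbr_def ssub_def)
  with br show ?case by (simp add: lie_gen.br)
qed

section \<open>Words as exponent vectors\<close>

lemma blocks_not_Nil [simp]: "blocks w \<noteq> []"
  by (induction w rule: blocks.induct) (auto simp: Let_def)

lemma unblocks_Cons: "as \<noteq> [] \<Longrightarrow> unblocks (a # as) = replicate a X @ Y # unblocks as"
  by (cases as) auto

lemma unblocks_blocks [simp]: "unblocks (blocks w) = w"
proof (induction w rule: blocks.induct)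
  case (2 w)
  then show ?case
    by (cases "blocks w"; cases "tl (blocks w)") (auto simp: Let_def)
qed (auto simp: unblocks_Cons)

lemma blocks_replicate: "blocks (replicate a X @ w) = (a + hd (blocks w)) # tl (blocks w)"
  by (induction a) (auto simp: Let_def)

text \<open>Both \<open>[]\<close> and \<open>[0]\<close> are sent to the empty word, whose exponent
  vector is \<open>[0]\<close>.\<close>

lemma blocks_unblocks [simp]: "as \<noteq> [] \<Longrightarrow> blocks (unblocks as) = as"
  using blocks_replicate[of _ "[]"]
  by (induction as rule: unblocks.induct) (auto simp: blocks_replicate)

lemma length_blocks: "length (blocks w) = Suc (ydeg w)"
  by (induction w rule: blocks.induct) (auto simp: Let_def ydeg_def)

lemma sum_list_blocks: "sum_list (blocks w) + ydeg w = length w"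
proof (induction w rule: blocks.induct)
  case (2 w)
  then show ?case by (cases "blocks w") (auto simp: Let_def ydeg_def)
qed (auto simp: ydeg_def)

lemma unblocks_snoc: "as \<noteq> [] \<Longrightarrow> unblocks (as @ [a]) = unblocks as @ Y # replicate a X"
  by (induction as rule: unblocks.induct) auto

lemma rev_unblocks: "rev (unblocks as) = unblocks (rev as)"
  using unblocks_snoc[of "_ @ [_]"] by (induction as rule: unblocks.induct) auto

text \<open>A word in the y_i ends in y, whence the trailing exponent 0.\<close>

lemma decode_eq: "decode v = unblocks (map (\<lambda>i. i - 1) v @ [0])"
  by (induction v) (auto simp: unblocks_Cons)

text \<open>Exponent vectors of the monomials of degree \<open>s\<close> in \<open>m\<close>
  variables.\<close>

definition expos :: "nat \<Rightarrow> nat \<Rightarrow> nat list set" where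
  "expos s m = {a. length a = m \<and> sum_list a = s}"

definition powmon :: "nat list \<Rightarrow> rat list \<Rightarrow> rat" where
  "powmon a z = prod_list (map2 (\<lambda>i x. x ^ i) a z)"

lemma powmon_Nil [simp]: "powmon [] z = 1"
  by (simp add: powmon_def)
lemma powmon_Cons [simp]: "powmon (i # a) (x # z) = x ^ i * powmon a z"
  by (simp add: powmon_def)

lemma powmon_append:
  "length a = length z \<Longrightarrow> powmon (a @ b) (z @ y) = powmon a z * powmon b y"
  by (simp add: powmon_def)

lemma powmon_rev: "length a = length z \<Longrightarrow> powmon (rev a) (rev z) = powmon a z"
  by (induction a z rule: list_induct2) (auto simp: powmon_append)

lemma powmon_rotate1: "length a = length z \<Longrightarrow> powmon (rotate1 a) (rotate1 z) = powmon a z"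
  by (cases a; cases z) (auto simp: powmon_append)

lemma finite_expos [simp]: "finite (expos s m)"
proof (rule finite_subset)
  show "expos s m \<subseteq> {a. set a \<subseteq> {..s} \<and> length a = m}"
    using member_le_sum_list by (fastforce simp: expos_def)
qed (rule finite_lists_length_eq, simp)

lemma ev_eq_powmon:
  "ev w z = (if length z = length (blocks w) then powmon (blocks w) z else 0)"
proof (induction w z rule: ev.induct)
  case (3 w z zs)
  then show ?case by (cases "blocks w") (auto simp: Let_def)
qed auto

lemma bij_unblocks:
  "r \<le> n \<Longrightarrow> bij_betw unblocks (expos (n - r) (Suc r)) {w. length w = n \<and> ydeg w = r}"
proof (rule bij_betw_byWitness[where f'=blocks], goal_cases)
  case 3
  have "length (unblocks a) = n \<and> ydeg (unblocks a) = r" if "a \<in> expos (n - r) (Suc r)" for a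
    using that 3 length_blocks[of "unblocks a"] sum_list_blocks[of "unblocks a"]
    by (cases "a = []") (auto simp: expos_def)
  then show ?case by auto
next
  case 4
  have "blocks w \<in> expos (length w - ydeg w) (Suc (ydeg w))" for w
    using length_blocks[of w] sum_list_blocks[of w] by (simp add: expos_def)
  then show ?case by auto
qed (auto simp: expos_def intro: blocks_unblocks)

lemma bihom_ydeg_le: "bihom n r f \<Longrightarrow> f \<noteq> szero \<Longrightarrow> r \<le> n"
  unfolding bihom_def szero_def fun_eq_iff by (metis sum_list_blocks le_add2)

lemma gf_bihom:
  assumes f: "bihom n r f" and z: "length z = Suc r" and rn: "r \<le> n"
  shows "gf f z = (\<Sum>a\<in>expos (n - r) (Suc r). f (unblocks a) * powmon a z)"
proof -
  have "finite {w. length w = n \<and> ydeg w = r}"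
    using bij_betw_finite[OF bij_unblocks[OF rn]] by simp
  then have "gf f z = (\<Sum>w\<in>{w. length w = n \<and> ydeg w = r}. f w * ev w z)"
    using f by (intro gf_superset) (auto simp: bihom_def)
  also have "\<dots> = (\<Sum>a\<in>expos (n - r) (Suc r). f (unblocks a) * ev (unblocks a) z)"
    by (rule sum.reindex_bij_betw[OF bij_unblocks[OF rn], symmetric])
  also have "\<dots> = (\<Sum>a\<in>expos (n - r) (Suc r). f (unblocks a) * powmon a z)"
  proof (intro sum.cong refl)
    fix a assume "a \<in> expos (n - r) (Suc r)"
    then have "length a = Suc r" "a \<noteq> []" by (auto simp: expos_def)
    then show "f (unblocks a) * ev (unblocks a) z = f (unblocks a) * powmon a z"
      using z by (simp add: ev_eq_powmon)
  qed
  finally show ?thesis .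
qed

lemma gf_bihom_length:
  assumes "bihom n r f" "length z \<noteq> Suc r"
  shows "gf f z = 0"
  unfolding gf_def using assms
  by (intro sum.neutral) (auto simp: bihom_def ev_eq_powmon length_blocks)

section \<open>Injectivity of the polynomial encoding\<close>

lemma polynomial_eq_0_rat:
  fixes c :: "nat \<Rightarrow> rat"
  assumes "\<And>x. (\<Sum>i\<le>n. c i * x ^ i) = 0" "i \<le> n"
  shows "c i = 0"
proof (rule ccontr)
  assume "c i \<noteq> 0"
  then have "finite {x::real. (\<Sum>i\<le>n. of_rat (c i) * x ^ i) = 0}"
    using assms(2) by (subst polyfun_finite_roots) auto
  \<comment> \<open>All naturals would be roots of a nonzero real polynomial.\<close>
  moreover have "range (of_nat :: nat \<Rightarrow> real) \<subseteq> {x. (\<Sum>i\<le>n. of_rat (c i) * x ^ i) = 0}"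
  proof clarify
    fix m :: nat
    have "(\<Sum>i\<le>n. of_rat (c i) * real m ^ i) = of_rat (\<Sum>i\<le>n. c i * of_nat m ^ i)"
      by (simp add: of_rat_sum of_rat_mult of_rat_power)
    then show "(\<Sum>i\<le>n. of_rat (c i) * real m ^ i) = 0" by (simp add: assms(1))
  qed
  ultimately have "finite (range (of_nat :: nat \<Rightarrow> real))" by (rule finite_subset[rotated])
  then show False
    by (simp add: finite_image_iff inj_def)
qed

text \<open>Induction on the number of variables: as a polynomial in the first variable, the sum has
  coefficients that vanish for all values of the others.\<close>

lemma powmon_independent:
  assumes "finite S" "\<And>a. a \<in> S \<Longrightarrow> length a = m"
    and "\<And>z. length z = m \<Longrightarrow> (\<Sum>a\<in>S. c a * powmon a z) = 0" and "a \<in> S"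
  shows "c a = 0"
  using assms
proof (induction m arbitrary: S c a)
  case 0
  then have "S = {[]}" by auto
  with 0(3)[of "[]"] 0(4) show ?case by simp
next
  case (Suc m)
  \<comment> \<open>\<open>S\<close> is enlarged to the rectangle of first exponents up to
    \<open>N\<close> and tails in \<open>T\<close>; \<open>d\<close> extends \<open>c\<close> by
    0.\<close>
  define N where "N = Max (hd ` S)"
  define T where "T = tl ` S"
  define d where "d a = (if a \<in> S then c a else 0)" for a
  have hd: "hd b \<le> N" if "b \<in> S" for b
    using that Suc.prems(1) by (simp add: N_def)
  have sub: "S \<subseteq> (\<lambda>(i, b). i # b) ` ({..N} \<times> T)"
  proof
    fix b assume b: "b \<in> S"
    with Suc.prems(2) have "b = hd b # tl b" by (cases b) fastforce+
    with b hd[OF b] show "b \<in> (\<lambda>(i, b). i # b) ` ({..N} \<times> T)"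
      unfolding T_def by (intro image_eqI[of _ _ "(hd b, tl b)"]) auto
  qed
  have T: "finite T" "\<And>b. b \<in> T \<Longrightarrow> length b = m"
    using Suc.prems(1,2) by (auto simp: T_def)
  have split: "(\<Sum>a\<in>S. c a * powmon a (x # z)) = (\<Sum>i\<le>N. (\<Sum>b\<in>T. d (i # b) * powmon b z) * x ^ i)" for x z
  proof -
    have "(\<Sum>a\<in>S. c a * powmon a (x # z)) = (\<Sum>a\<in>(\<lambda>(i, b). i # b) ` ({..N} \<times> T). d a * powmon a (x # z))"
      using sub T by (intro sum.mono_neutral_cong_left) (auto simp: d_def)
    also have "\<dots> = (\<Sum>(i, b)\<in>{..N} \<times> T. d (i # b) * powmon (i # b) (x # z))"
      by (subst sum.reindex) (auto simp: inj_on_def case_prod_unfold)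
    also have "\<dots> = (\<Sum>i\<le>N. \<Sum>b\<in>T. d (i # b) * powmon (i # b) (x # z))"
      by (rule sum.cartesian_product[symmetric])
    finally show ?thesis unfolding sum_distrib_right by (simp add: mult_ac)
  qed
  obtain i b where a: "a = i # b" "i \<le> N" "b \<in> T"
    using sub Suc.prems(4) by auto
  have "(\<Sum>b\<in>T. d (i # b) * powmon b z) = 0" if "length z = m" for z
  proof (rule polynomial_eq_0_rat[OF _ a(2), where c="\<lambda>i. \<Sum>b\<in>T. d (i # b) * powmon b z"])
    fix x
    show "(\<Sum>i\<le>N. (\<Sum>b\<in>T. d (i # b) * powmon b z) * x ^ i) = 0"
      using Suc.prems(3)[of "x # z"] that by (simp add: split)
  qed
  then have "d (i # b) = 0"
    by (intro Suc.IH[OF T, where c="\<lambda>b. d (i # b)"] a(3)) auto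
  with a Suc.prems(4) show ?case by (simp add: d_def)
qed

lemma gf_eq_0:
  assumes f: "bihom n r f" and "\<And>z. length z = Suc r \<Longrightarrow> gf f z = 0"
  shows "f = szero"
proof (rule ccontr)
  assume ne: "f \<noteq> szero"
  with f have rn: "r \<le> n" by (rule bihom_ydeg_le)
  have "f w = 0" for w
  proof (cases "length w = n \<and> ydeg w = r")
    case True
    then have "blocks w \<in> expos (n - r) (Suc r)"
      using sum_list_blocks[of w] length_blocks[of w] by (auto simp: expos_def)
    moreover have "(\<Sum>a\<in>expos (n - r) (Suc r). f (unblocks a) * powmon a z) = 0" if "length z = Suc r" for z
      using assms(2)[OF that] gf_bihom[OF f that rn] by simp
    ultimately have "f (unblocks (blocks w)) = 0"
      by (intro powmon_independent[where c="\<lambda>a. f (unblocks a)" and S="expos (n - r) (Suc r)" and m="Suc r"])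
        (auto, auto simp: expos_def)
    then show ?thesis by simp
  qed (use f in \<open>auto simp: bihom_def\<close>)
  with ne show False by (auto simp: szero_def)
qed

lemma bihom_unblocks:
  "bihom n r f \<Longrightarrow> a \<noteq> [] \<Longrightarrow> f (unblocks a) \<noteq> 0 \<Longrightarrow> a \<in> expos (n - r) (Suc r)"
  using length_blocks[of "unblocks a"] sum_list_blocks[of "unblocks a"]
  by (fastforce simp: bihom_def expos_def)

text \<open>Moves a permutation of the variables onto the exponents; an injective self-map of a
  finite set is bijective.\<close>

lemma sum_expos_permute:
  assumes len: "\<And>a :: nat list. length (p a) = length a"
    and sum: "\<And>a. sum_list (p a) = sum_list a" and inj: "inj p"
    and pow: "\<And>a. length a = m \<Longrightarrow> powmon (p a) z' = powmon a z"
  shows "(\<Sum>a\<in>expos s m. F a * powmon a z') = (\<Sum>a\<in>expos s m. F (p a) * powmon a z)"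
proof -
  have "p ` expos s m \<subseteq> expos s m" by (auto simp: expos_def len sum)
  then have "bij_betw p (expos s m) (expos s m)"
    using inj_on_subset[OF inj subset_UNIV] by (simp add: bij_betw_def endo_inj_surj)
  from sum.reindex_bij_betw[OF this, of "\<lambda>a. F a * powmon a z'"]
  have "(\<Sum>a\<in>expos s m. F a * powmon a z') = (\<Sum>a\<in>expos s m. F (p a) * powmon (p a) z')"
    by simp
  also have "\<dots> = (\<Sum>a\<in>expos s m. F (p a) * powmon a z)"
    by (intro sum.cong) (auto simp: expos_def pow)
  finally show ?thesis .
qed

text \<open>Setting z_0 = 0 keeps exactly the words that start with y, since 0^0 = 1.\<close>

lemma gf_Cons_0:
  assumes "bihom n r f" "r \<le> n" "length z = r"
  shows "gf f (0 # z) = (\<Sum>b\<in>expos (n - r) r. f (unblocks (0 # b)) * powmon b z)"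
proof -
  have "gf f (0 # z) = (\<Sum>a\<in>expos (n - r) (Suc r). f (unblocks a) * powmon a (0 # z))"
    using assms by (intro gf_bihom) auto
  also have "\<dots> = (\<Sum>a\<in>(#) 0 ` expos (n - r) r. f (unblocks a) * powmon a (0 # z))"
  proof (rule sum.mono_neutral_right)
    show "(#) 0 ` expos (n - r) r \<subseteq> expos (n - r) (Suc r)"
      by (auto simp: expos_def)
    show "\<forall>a\<in>expos (n - r) (Suc r) - (#) 0 ` expos (n - r) r. f (unblocks a) * powmon a (0 # z) = 0"
      by (auto simp: expos_def length_Suc_conv)
  qed simp
  also have "\<dots> = (\<Sum>b\<in>expos (n - r) r. f (unblocks (0 # b)) * powmon b z)"
    by (subst sum.reindex) auto
  finally show ?thesis .
qed

lemma sum_list_rotate1: "sum_list (rotate1 a) = sum_list (a :: nat list)"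
  by (cases a) auto

section \<open>Lie polynomials of fixed weight and depth\<close>

lemma lie_xy_linear: "lie_gen {xs, ys} \<subseteq> lie_gen linear_ser"
  by (rule lie_gen_subset) (auto simp: linear_ser_def xs_def ys_def mono_def intro!: lie_gen.gen)

lemma lie_ygens_linear: "lie_gen ygens \<subseteq> lie_gen linear_ser"
  by (rule lie_gen_subset) (auto simp: linear_ser_def ygens_def mono_def intro!: lie_gen.gen)

lemma lie_Cgens_xy: "lie_gen Cgens \<subseteq> lie_gen {xs, ys}"
proof (rule lie_gen_subset, rule subsetI)
  fix g assume "g \<in> Cgens"
  then show "g \<in> lie_gen {xs, ys}"
    by (induction rule: Cgens_induct) (auto intro: lie_gen.gen lie_gen.br)
qed

lemma hpart_bihom: "bihom n r f \<Longrightarrow> hpart k f = (if k = n then f else szero)"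
  by (auto simp: hpart_def bihom_def szero_def fun_eq_iff)

lemma lie_compl_bihom: "bihom n r f \<Longrightarrow> f \<in> lie_compl G \<longleftrightarrow> f \<in> lie_gen G"
  by (auto simp: lie_compl_def hpart_bihom lie_gen.zero)

lemma lieC_eq: "lieC = lie_compl Cgens"
  by (simp add: lieC_def Cgens_def)

lemma lieC_subset_lie2: "lieC \<subseteq> lie2"
  using lie_Cgens_xy by (auto simp: lieC_eq lie2_def lie_compl_def)

text \<open>By Lazard elimination only a multiple of x could be in the way, and the coefficient at
  \<open>[X]\<close> excludes it in weight at least 2.\<close>

lemma lie2_bihom_Cgens:
  assumes "f \<in> lie2" "bihom n r f" "2 \<le> n"
  shows "f \<in> lie_gen Cgens"
proof -
  have "f \<in> lie_gen {xs, ys}"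
    using assms by (simp add: lie2_def lie_compl_bihom)
  then obtain c g where g: "g \<in> lie_gen Cgens" "f = sadd (sscale c xs) g"
    using lie_xy_decompose by blast
  have "f [X] = 0" using assms by (auto simp: bihom_def)
  moreover have "g [X] = 0" using g by (intro lie_Cgens_ydeg_0) (auto simp: ydeg_def)
  ultimately have "c = 0" using g by (simp add: ser_defs xs_def mono_def)
  then have "f = g" using g by (simp add: ser_defs)
  with g show ?thesis by simp
qed

section \<open>The push conditions on exponent vectors\<close>

lemma push_invariant_iff:
  "push f = f \<longleftrightarrow> (\<forall>a. f (unblocks (rotate1 a)) = f (unblocks a))"
proof
  assume p: "push f = f"
  show "\<forall>a. f (unblocks (rotate1 a)) = f (unblocks a)"
  proof
    fix a
    show "f (unblocks (rotate1 a)) = f (unblocks a)"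
      using fun_cong[OF p, of "unblocks a"] by (cases "a = []") (auto simp: push_def unpush_word_def)
  qed
next
  assume "\<forall>a. f (unblocks (rotate1 a)) = f (unblocks a)"
  then show "push f = f" by (auto simp: push_def unpush_word_def)
qed

lemma push_power: "(push ^^ i) p u = p (unblocks (rotate i (blocks u)))"
proof (induction i arbitrary: u)
  case (Suc i)
  then show ?case
    by (simp add: push_def unpush_word_def rotate1_rotate_swap)
qed simp

text \<open>A leading y is a leading exponent 0; the push operator rotates only the remaining
  exponents.\<close>

lemma push_neutral_yder_iff:
  "push_neutral s (yder f) \<longleftrightarrow> (\<forall>a. a \<noteq> [] \<longrightarrow> (\<Sum>i\<le>s. f (unblocks (0 # rotate i a))) = 0)"
proof -
  have "yder f (unblocks (rotate i a)) = f (unblocks (0 # rotate i a))" if "a \<noteq> []" for i a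
    using that by (simp add: yder_def unblocks_Cons)
  then have "(\<Sum>i\<le>s. (push ^^ i) (yder f) u) = (\<Sum>i\<le>s. f (unblocks (0 # rotate i (blocks u))))" for u
    by (simp add: push_power)
  then have "push_neutral s (yder f) \<longleftrightarrow> (\<forall>u. (\<Sum>i\<le>s. f (unblocks (0 # rotate i (blocks u)))) = 0)"
    by (simp add: push_neutral_def szero_def fun_eq_iff)
  also have "\<dots> \<longleftrightarrow> (\<forall>a. a \<noteq> [] \<longrightarrow> (\<Sum>i\<le>s. f (unblocks (0 # rotate i a))) = 0)"
    by (metis blocks_not_Nil blocks_unblocks)
  finally show ?thesis .
qed

lemma piy_map_Suc: "a \<noteq> [] \<Longrightarrow> piy f (map Suc a) = f (unblocks (a @ [0]))"
  by (auto simp: piy_def decode_eq comp_def)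

lemma psums_snoc: "psums c (us @ [u]) = psums c us @ [c + sum_list us + u]"
  by (induction us arbitrary: c) (auto simp: add.assoc)

lemma psums_surj: "z \<noteq> [] \<Longrightarrow> \<exists>us. z = psums (hd z) us"
proof (induction z)
  case (Cons c z)
  show ?case
  proof (cases "z = []")
    case False
    with Cons obtain us where "z = psums (hd z) us" by blast
    then have "c # z = psums c ((hd z - c) # us)" by simp
    then show ?thesis by (metis list.sel(1))
  qed (auto intro: exI[of _ "[]"])
qed simp

section \<open>Push-invariance for a fixed Lie element of weight n and depth r\<close>

locale bihom_lie =
  fixes f :: "letter ser" and n r :: nat
  assumes lie: "f \<in> lie_gen Cgens" and bihom: "bihom n r f" and le: "r \<le> n"
begin

lemma coeff_rev: "f (rev w) = - ((-1) ^ n * f w)"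
proof (cases "length w = n")
  case True
  then show ?thesis
    using lie_linear_rev lie lie_Cgens_xy lie_xy_linear by blast
next
  case False
  then have "f w = 0" "f (rev w) = 0" using bihom by (auto simp: bihom_def)
  then show ?thesis by simp
qed

lemma gf_rev: "gf f (rev z) = - ((-1) ^ n * gf f z)"
proof (cases "length z = Suc r")
  case True
  have "gf f (rev z) = (\<Sum>a\<in>expos (n - r) (Suc r). f (unblocks (rev a)) * powmon a z)"
    using True by (subst gf_bihom[OF bihom _ le])
      (auto intro!: sum_expos_permute[where F="\<lambda>a. f (unblocks a)"] powmon_rev)
  also have "\<dots> = - ((-1) ^ n * gf f z)"
    using True
    by (simp add: gf_bihom[OF bihom _ le] coeff_rev sum_distrib_left sum_negf mult.assoc flip: rev_unblocks)
  finally show ?thesis .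
qed (simp add: gf_bihom_length[OF bihom])

lemma gf_push: "length z = Suc r \<Longrightarrow>
    gf f (rotate1 z) = (\<Sum>a\<in>expos (n - r) (Suc r). f (unblocks (rotate1 a)) * powmon a z)"
  by (subst gf_bihom[OF bihom _ le])
    (auto intro!: sum_expos_permute[where F="\<lambda>a. f (unblocks a)"] powmon_rotate1 inj_rotate1 sum_list_rotate1)

lemma bihom_push: "bihom n r (push f)"
  unfolding bihom_def
proof (intro allI impI)
  fix u assume "push f u \<noteq> 0"
  then have "rotate1 (blocks u) \<in> expos (n - r) (Suc r)"
    by (intro bihom_unblocks[OF bihom]) (auto simp: push_def unpush_word_def)
  then show "length u = n \<and> ydeg u = r"
    using length_blocks[of u] sum_list_blocks[of u] le by (auto simp: expos_def sum_list_rotate1)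
qed

text \<open>Rotating the variables rotates the exponents. For the converse, the difference
  \<open>push f - f\<close> has vanishing generating function.\<close>

lemma push_invariant_gf:
  "push f = f \<longleftrightarrow> (\<forall>z. gf f (rotate1 z) = gf f z)"
proof
  assume "push f = f"
  then have *: "f (unblocks (rotate1 a)) = f (unblocks a)" for a
    by (simp add: push_invariant_iff)
  show "\<forall>z. gf f (rotate1 z) = gf f z"
  proof
    fix z
    show "gf f (rotate1 z) = gf f z"
    proof (cases "length z = Suc r")
      case True
      then show ?thesis by (simp only: gf_push gf_bihom[OF bihom _ le] *)
    qed (simp add: gf_bihom_length[OF bihom])
  qed
next
  assume *: "\<forall>z. gf f (rotate1 z) = gf f z"
  have "ssub (push f) f = szero"
  proof (rule gf_eq_0)
    show "bihom n r (ssub (push f) f)"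
      using bihom bihom_push by (simp add: bihom_def ssub_def) metis
    fix z :: "rat list" assume z: "length z = Suc r"
    have "gf (ssub (push f) f) z
        = (\<Sum>a\<in>expos (n - r) (Suc r). push f (unblocks a) * powmon a z) - gf f z"
      using z \<open>bihom n r (ssub (push f) f)\<close>
      by (simp add: gf_bihom[OF _ _ le] bihom ssub_def algebra_simps sum_subtractf)
    also have "(\<Sum>a\<in>expos (n - r) (Suc r). push f (unblocks a) * powmon a z) = gf f (rotate1 z)"
      unfolding gf_push[OF z]
    proof (intro sum.cong refl)
      fix a assume "a \<in> expos (n - r) (Suc r)"
      then have "a \<noteq> []" by (auto simp: expos_def)
      then show "push f (unblocks a) * powmon a z = f (unblocks (rotate1 a)) * powmon a z"
        by (simp add: push_def unpush_word_def)
    qed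
    finally show "gf (ssub (push f) f) z = 0" using * by simp
  qed
  then show "push f = f" by (auto simp: ssub_def szero_def fun_eq_iff)
qed

text \<open>Inserting \<open>u\<^sub>1\<close> into the cyclic word \<open>(u\<^sub>0, u\<^sub>2, \<dots>, u\<^sub>r)\<close>, where \<open>u\<^sub>0 + \<dots> + u\<^sub>r = 0\<close>, gives a shuffle
  relation for every starting point. If rotation changes the sign, the relations read from \<open>u\<^sub>0\<close> and
  from \<open>u\<^sub>2\<close> agree up to sign in all terms except the one with \<open>u\<^sub>1\<close> between \<open>u\<^sub>0\<close> and \<open>u\<^sub>2\<close>.\<close>

lemma eq_0_if_push_anti_invariant:
  assumes rot: "\<And>z. gf f (rotate1 z) = - gf f z" and r: "2 \<le> r"
  shows "f = szero"
proof -
  let ?A = "dgf f"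
  have A: "?A \<in> lie_gen linear_ser" using lie by (rule dgf_lie)
  \<comment> \<open>\<open>x\<close> is the closing difference z_0 - z_r, so all differences around
    the cycle sum to 0. Starting the partial sums at \<open>u\<close> costs nothing by translation
    invariance.\<close>
  have cyc: "?A (us @ [x]) = - ?A (u # us)" if "x = - (u + sum_list us)" for u us x
  proof -
    have "?A (us @ [x]) = gf f (psums u (us @ [x]))"
      by (simp add: gf_psums[OF lie])
    also have "psums u (us @ [x]) = rotate1 (psums 0 (u # us))"
      using that by (simp add: psums_snoc)
    finally show ?thesis by (simp only: rot dgf_def)
  qed
  have *: "?A (u1 # u2 # vs) = 0" for u1 u2 vs
  proof -
    define u0 where "u0 = - (u1 + u2 + sum_list vs)"
    have "insert_sum u1 (\<lambda>v. ?A (v @ [u0])) vs = insert_sum u1 (\<lambda>v. (-1) * ?A (u2 # v)) vs"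
    proof (rule insert_sum_cong)
      fix v assume "sum_list v = u1 + sum_list vs"
      then show "?A (v @ [u0]) = (-1) * ?A (u2 # v)"
        using cyc[of u0 u2 v] by (simp add: u0_def)
    qed
    then have 1: "insert_sum u1 (\<lambda>v. ?A (v @ [u0])) vs = - insert_sum u1 (\<lambda>v. ?A (u2 # v)) vs"
      by (simp only: insert_sum_scale)
    have 2: "insert_sum u1 ?A (u2 # vs) = 0" "insert_sum u1 ?A (vs @ [u0]) = 0"
      by (simp_all add: insert_sum_linear[OF A] del: insert_sum.simps)
    \<comment> \<open>Two rotations show that the values at \<open>u1 # u2 # vs\<close> and
      \<open>vs @ [u0, u1]\<close> agree, whereas the shuffle relations in \<open>2\<close>,
      combined with \<open>1\<close>, make them opposite.\<close>
    have "?A (u1 # u2 # vs) = - ?A (u2 # vs @ [u0])"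
      using cyc[of u0 u1 "u2 # vs"] by (simp add: u0_def)
    also have "\<dots> = ?A (vs @ [u0, u1])"
      using cyc[of u1 u2 "vs @ [u0]"] by (simp add: u0_def)
    finally show ?thesis
      using 1 2 by (simp add: insert_sum_snoc)
  qed
  show ?thesis
  proof (rule gf_eq_0[OF bihom])
    fix z :: "rat list" assume z: "length z = Suc r"
    then have "z \<noteq> []" by auto
    then obtain us where us: "z = psums (hd z) us" using psums_surj by blast
    then have "length us = r" using z by (metis length_psums Suc_inject)
    with r obtain u1 u2 vs where "us = u1 # u2 # vs"
      by (metis One_nat_def Suc_1 Suc_le_length_iff)
    with * show "gf f z = 0" by (subst us) (simp only: gf_psums[OF lie])
  qed
qed

lemma push_invariant_if_piy_lie:
  assumes piy: "piy f \<in> lie_gen ygens" and r: "1 \<le> r" and odd: "r = 1 \<Longrightarrow> odd n"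
  shows "push f = f"
proof -
  \<comment> \<open>The antipode of f carries the relation for words ending in y to words starting
    with y; its sign (-1)^n enters twice and cancels.\<close>
  have hd: "f (unblocks (0 # rev b)) = - ((-1) ^ r * f (unblocks (0 # b)))" if "length b = r" for b
  proof -
    have b: "b \<noteq> []" using that r by auto
    have "f (unblocks (rev b @ [0])) = - ((-1) ^ r * f (unblocks (b @ [0])))"
      using lie_linear_rev[OF subsetD[OF lie_ygens_linear piy], of "map Suc b"] b that
      by (simp add: piy_map_Suc rev_map)
    moreover have "f (unblocks (rev b @ [0])) = - ((-1) ^ n * f (unblocks (0 # b)))"
                  "f (unblocks (0 # rev b)) = - ((-1) ^ n * f (unblocks (b @ [0])))"
      using coeff_rev[of "unblocks (0 # b)"] coeff_rev[of "unblocks (b @ [0])"]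
      by (simp_all add: rev_unblocks)
    ultimately show ?thesis by (cases "even n") auto
  qed
  have "gf f (c # rev z) = - ((-1) ^ r * gf f (c # z))" if z: "length z = r" for c z
  proof -
    have 0: "gf f (0 # rev z) = - ((-1) ^ r * gf f (0 # z))" if "length z = r" for z
    proof -
      have "gf f (0 # rev z) = (\<Sum>b\<in>expos (n - r) r. f (unblocks (0 # rev b)) * powmon b z)"
        using that by (subst gf_Cons_0[OF bihom le])
          (auto intro!: sum_expos_permute[where F="\<lambda>b. f (unblocks (0 # b))"] powmon_rev)
      also have "\<dots> = (\<Sum>b\<in>expos (n - r) r. - ((-1) ^ r * f (unblocks (0 # b))) * powmon b z)"
        by (intro sum.cong) (auto simp: expos_def hd)
      finally show ?thesis
        using that by (simp add: gf_Cons_0[OF bihom le] sum_distrib_left sum_negf mult.assoc)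
    qed
    \<comment> \<open>Translation by c extends the relation from z_0 = 0 to arbitrary z_0.\<close>
    show ?thesis
      using gf_translate[OF lie, of c "0 # rev (map ((+) (- c)) z)"]
        gf_translate[OF lie, of c "0 # map ((+) (- c)) z"] 0[of "map ((+) (- c)) z"] z
      by (simp add: rev_map comp_def)
  qed
  note tail = this
  \<comment> \<open>Reversing z_1, ..., z_r and then all variables is one rotation.\<close>
  have rot: "gf f (rotate1 z) = (-1) ^ (n + r) * gf f z" for z
  proof (cases "length z = Suc r")
    case True
    then obtain c z' where z: "z = c # z'" "length z' = r" by (cases z) auto
    then have "gf f (rotate1 z) = gf f (rev (c # rev z'))" by simp
    also have "\<dots> = - ((-1) ^ n * gf f (c # rev z'))" by (rule gf_rev)
    also have "\<dots> = (-1) ^ (n + r) * gf f z"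
      using z tail[of z' c] by (simp add: power_add)
    finally show ?thesis .
  qed (simp add: gf_bihom_length[OF bihom])
  show ?thesis
  proof (cases "even (n + r)")
    case True
    then show ?thesis using rot by (simp add: push_invariant_gf)
  next
    case False
    then have "2 \<le> r" using odd r by (cases "r = 1") auto
    moreover have "gf f (rotate1 z) = - gf f z" for z
      using rot False by simp
    ultimately have "f = szero" by (intro eq_0_if_push_anti_invariant) auto
    then show ?thesis by (simp add: push_def szero_def)
  qed
qed

end

section \<open>Push-neutrality and Lie polynomials in the y_i\<close>

context bihom_lie
begin

text \<open>Push-invariance moves the leading exponent 0 to the end, identifying the coefficients of
  f^y and f_y.\<close>

lemma coeff_0_Cons:
  assumes "push f = f" "a \<noteq> []"
  shows "f (unblocks (0 # a)) = piy f (map Suc a)"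
  using assms push_invariant_iff[of f] by (metis piy_map_Suc rotate1.simps(2))

lemma map_Suc_pred: "0 \<notin> set v \<Longrightarrow> map Suc (map (\<lambda>i. i - 1) v) = v"
  by (induction v) auto

lemma push_neutral_yder_iff_piy:
  assumes "push f = f"
  shows "push_neutral s (yder f) \<longleftrightarrow> (\<forall>v. (\<Sum>i\<le>s. piy f (rotate i v)) = 0)"
proof -
  have "push_neutral s (yder f)
      \<longleftrightarrow> (\<forall>a. a \<noteq> [] \<longrightarrow> (\<Sum>i\<le>s. piy f (rotate i (map Suc a))) = 0)"
    using assms by (simp add: push_neutral_yder_iff coeff_0_Cons rotate_map)
  also have "\<dots> \<longleftrightarrow> (\<forall>v. (\<Sum>i\<le>s. piy f (rotate i v)) = 0)"
  proof safe
    fix v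
    assume *: "\<forall>a. a \<noteq> [] \<longrightarrow> (\<Sum>i\<le>s. piy f (rotate i (map Suc a))) = 0"
    show "(\<Sum>i\<le>s. piy f (rotate i v)) = 0"
    proof (cases "v = [] \<or> 0 \<in> set v")
      \<comment> \<open>Such lists do not encode words in the y_i; \<open>piy\<close> is 0 on them
        and on their rotations.\<close>
      case True
      then show ?thesis by (intro sum.neutral) (auto simp: piy_def)
    next
      case False
      then show ?thesis using * map_Suc_pred[of v] by (metis map_is_Nil_conv)
    qed
  qed auto
  finally show ?thesis .
qed

lemma piy_support:
  assumes "piy f v \<noteq> 0"
  shows "length v = r \<and> set v \<subseteq> {1..n}"
proof -
  have v: "v \<noteq> []" "0 \<notin> set v" "f (unblocks (map (\<lambda>i. i - 1) v @ [0])) \<noteq> 0"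
    using assms by (auto simp: piy_def decode_eq split: if_splits)
  then have e: "map (\<lambda>i. i - 1) v @ [0] \<in> expos (n - r) (Suc r)"
    by (intro bihom_unblocks[OF bihom]) auto
  then have len: "length v = r" by (simp add: expos_def)
  have "i \<in> {1..n}" if "i \<in> set v" for i
  proof -
    have "i - 1 \<le> sum_list (map (\<lambda>i. i - 1) v)"
      using that by (intro member_le_sum_list) auto
    also have "\<dots> = n - r" using e by (simp add: expos_def)
    finally have "i - 1 \<le> n - r" .
    moreover have "r \<noteq> 0" using len v(1) by auto
    moreover have "i \<noteq> 0" using that v(2) by metis
    ultimately show ?thesis using le by auto
  qed
  with len show ?thesis by auto
qed

text \<open>On words of length r the sum runs over all r rotations and is the cyclic trace of a Lie
  polynomial; on other lengths every term is 0.\<close>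

lemma push_neutral_if_piy_lie:
  assumes "piy f \<in> lie_gen ygens" "push f = f" "2 \<le> r"
  shows "push_neutral (r - 1) (yder f)"
  unfolding push_neutral_yder_iff_piy[OF assms(2)]
proof
  fix v
  show "(\<Sum>i\<le>r - 1. piy f (rotate i v)) = 0"
  proof (cases "length v = r")
    case True
    moreover have "{..r - 1} = {..<r}" using assms(3) by auto
    ultimately show ?thesis
      using lie_linear_cyclic_sum[OF subsetD[OF lie_ygens_linear assms(1)], of v] assms(3) by simp
  next
    case False
    then show ?thesis using piy_support by (intro sum.neutral ballI) (metis length_rotate)
  qed
qed

text \<open>A finite set containing the support of \<open>piy f\<close>, used as index set of the
  Dynkin sums.\<close>

definition words :: "nat list set" where
  "words = {v. set v \<subseteq> {1..n} \<and> length v = r}"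

lemma finite_words: "finite words"
  unfolding words_def by (rule finite_lists_length_eq) simp

lemma piy_not_words: "v \<notin> words \<Longrightarrow> piy f v = 0"
  using piy_support[of v] by (auto simp: words_def)

lemma words_length: "v \<in> words \<Longrightarrow> length v = r"
  by (simp add: words_def)

lemma mono_words_lie: "v \<in> words \<Longrightarrow> i < r \<Longrightarrow> mono [v ! i] \<in> lie_gen ygens"
  by (rule lie_gen.gen) (force simp: words_def ygens_def dest: nth_mem)

text \<open>Extracts one coefficient after the letters are rearranged by \<open>p\<close>. The word
  \<open>u\<close> may lie outside \<open>words\<close>, where \<open>piy f\<close> is 0.\<close>

lemma sum_words_mono:
  assumes "\<And>v. v \<in> words \<Longrightarrow> p v = w \<longleftrightarrow> v = u"
  shows "(\<Sum>v\<in>words. piy f v * mono (p v) w) = piy f u"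
proof -
  have "mono (p v) w = (if v = u then 1 else 0)" if "v \<in> words" for v
    using assms[OF that] by (auto simp: mono_def)
  then have "(\<Sum>v\<in>words. piy f v * mono (p v) w) = (\<Sum>v\<in>words. if v = u then piy f v else 0)"
    by (intro sum.cong) auto
  also have "\<dots> = piy f u"
    using finite_words piy_not_words by auto
  finally show ?thesis .
qed

lemma piy_lie_1:
  assumes "r = 1"
  shows "piy f \<in> lie_gen ygens"
proof -
  have "piy f w = (\<Sum>v\<in>words. sscale (piy f v) (mono [v ! 0]) w)" for w
  proof -
    have "[v ! 0] = v" if "v \<in> words" for v
      using words_length[OF that] assms by (auto simp: length_Suc_conv)
    then show ?thesis
      using sum_words_mono[of "\<lambda>v. [v ! 0]" w w] by (simp add: sscale_def)
  qed
  then have "piy f = (\<lambda>w. \<Sum>v\<in>words. sscale (piy f v) (mono [v ! 0]) w)" by blast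
  also have "\<dots> \<in> lie_gen ygens"
    using assms by (intro lie_gen_sum finite_words lie_gen.scale mono_words_lie) auto
  finally show ?thesis .
qed

text \<open>Dynkin's formula: antisymmetry makes the sum of the brackets, weighted by the
  coefficients, equal to twice \<open>piy f\<close>.\<close>

lemma piy_lie_2:
  assumes r: "r = 2" and anti: "\<And>a b. piy f [a, b] + piy f [b, a] = 0"
  shows "piy f \<in> lie_gen ygens"
proof -
  let ?b = "\<lambda>v. sbr (mono [v ! 0]) (mono [v ! 1])"
  let ?s = "\<lambda>w. \<Sum>v\<in>words. sscale (piy f v) (?b v) w"
  have *: "?s w = (\<Sum>v\<in>words. piy f v * mono [v ! 0, v ! 1] w) - (\<Sum>v\<in>words. piy f v * mono [v ! 1, v ! 0] w)" for w
    by (simp add: ser_defs mono_append algebra_simps sum_subtractf)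
  have "piy f w = sscale (1 / 2) ?s w" for w
  proof (cases "length w = 2")
    case True
    then obtain a b where w: "w = [a, b]" by (auto simp: length_Suc_conv numeral_2_eq_2)
    have "?s w = piy f [a, b] - piy f [b, a]"
      unfolding * w
      by (intro arg_cong2[where f="(-)"] sum_words_mono; drule words_length; simp only: r)
        (auto simp: numeral_2_eq_2 length_Suc_conv)
    then show ?thesis using anti[of a b] w by (simp add: sscale_def)
  next
    case False
    then have "piy f w = 0" using piy_support r by blast
    moreover have "mono v w = 0" if "length v \<noteq> length w" for v
      using that by (auto simp: mono_def)
    then have "?s w = 0" unfolding * using False by simp
    ultimately show ?thesis by (simp add: sscale_def)
  qed
  then have "piy f = sscale (1 / 2) ?s" by blast
  also have "\<dots> \<in> lie_gen ygens"
    using r by (intro lie_gen_sum finite_words lie_gen.scale lie_gen.br mono_words_lie) auto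
  finally show ?thesis .
qed

text \<open>Dynkin's formula with left-normed brackets. The coefficient at abc is that of abc + cba
  - bac - bca in \<open>piy f\<close>, which the two relations turn into three times that of
  abc.\<close>

lemma piy_lie_3:
  assumes r: "r = 3" and sh: "\<And>a b c. piy f [a, b, c] + piy f [b, a, c] + piy f [b, c, a] = 0"
    and rev: "\<And>a b c. piy f [c, b, a] = piy f [a, b, c]"
  shows "piy f \<in> lie_gen ygens"
proof -
  let ?b = "\<lambda>v. sbr (sbr (mono [v ! 0]) (mono [v ! 1])) (mono [v ! 2])"
  let ?s = "\<lambda>w. \<Sum>v\<in>words. sscale (piy f v) (?b v) w"
  have *: "?s w = (\<Sum>v\<in>words. piy f v * mono [v ! 0, v ! 1, v ! 2] w) - (\<Sum>v\<in>words. piy f v * mono [v ! 1, v ! 0, v ! 2] w)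
      - ((\<Sum>v\<in>words. piy f v * mono [v ! 2, v ! 0, v ! 1] w) - (\<Sum>v\<in>words. piy f v * mono [v ! 2, v ! 1, v ! 0] w))" for w
    by (simp add: ser_defs smult_linear mono_append algebra_simps sum_subtractf sum.distrib)
  have "piy f w = sscale (1 / 3) ?s w" for w
  proof (cases "length w = 3")
    case True
    then obtain a b c where w: "w = [a, b, c]" by (auto simp: length_Suc_conv numeral_3_eq_3)
    have "?s w = piy f [a, b, c] - piy f [b, a, c] - (piy f [b, c, a] - piy f [c, b, a])"
      unfolding * w
      by (intro arg_cong2[where f="(-)"] sum_words_mono; drule words_length; simp only: r)
        (auto simp: numeral_3_eq_3 numeral_2_eq_2 length_Suc_conv)
    then show ?thesis using sh[of a b c] rev[of c b a] w by (simp add: sscale_def)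
  next
    case False
    then have "piy f w = 0" using piy_support r by blast
    moreover have "mono v w = 0" if "length v \<noteq> length w" for v
      using that by (auto simp: mono_def)
    then have "?s w = 0" unfolding * using False by simp
    ultimately show ?thesis by (simp add: sscale_def)
  qed
  then have "piy f = sscale (1 / 3) ?s" by blast
  also have "\<dots> \<in> lie_gen ygens"
    using r by (intro lie_gen_sum finite_words lie_gen.scale lie_gen.br mono_words_lie) auto
  finally show ?thesis .
qed

text \<open>In depth 1, push and reversal both swap the two exponents, but in even weight reversal
  changes the sign.\<close>

lemma odd_if_depth_1:
  assumes push: "push f = f" and "r = 1" "f \<noteq> szero"
  shows "odd n"
proof
  assume "even n"
  have "f w = 0" for w
  proof (cases "ydeg w = 1")
    case True
    then obtain a b where ab: "blocks w = [a, b]"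
      using length_blocks[of w] by (auto simp: length_Suc_conv)
    have "f (unblocks [b, a]) = - f (unblocks [a, b])"
      using coeff_rev[of "unblocks [a, b]"] \<open>even n\<close> rev_unblocks[of "[a, b]"] by simp
    moreover have "f (unblocks [b, a]) = f (unblocks [a, b])"
      using push push_invariant_iff[of f] by (metis rotate1.simps(2) append_Cons append_Nil)
    ultimately have "f (unblocks (blocks w)) = 0" by (simp only: ab)
    then show ?thesis by simp
  qed (use bihom assms(2) in \<open>auto simp: bihom_def\<close>)
  with assms(3) show False by (auto simp: szero_def)
qed

text \<open>Translation invariance makes the neutrality relation equivariant under all permutations of
  \<open>z\<^sub>0, \<dots>, z\<^sub>3\<close>; in even weight, its versions based at \<open>z\<^sub>0\<close> and at \<open>z\<^sub>2\<close> have opposite last two terms.\<close>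

lemma odd_if_depth_3:
  assumes push: "push f = f" and neutral: "push_neutral 2 (yder f)" and r: "r = 3" and "f \<noteq> szero"
  shows "odd n"
proof
  assume "even n"
  let ?P = "gf f"
  have rot: "?P [b, c, d, a] = ?P [a, b, c, d]" for a b c d
  proof -
    have "?P (rotate1 [a, b, c, d]) = ?P [a, b, c, d]"
      using push by (simp only: push_invariant_gf)
    then show ?thesis by simp
  qed
  have rev: "?P [d, c, b, a] = - ?P [a, b, c, d]" for a b c d
    using gf_rev[of "[a, b, c, d]"] \<open>even n\<close> by simp
  \<comment> \<open>Neutrality as a polynomial identity at z_0 = 0; translation then yields
    \<open>N\<close> at every base point.\<close>
  have 0: "?P (0 # z) + ?P (0 # rotate1 z) + ?P (0 # rotate1 (rotate1 z)) = 0" if z: "length z = 3" for z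
  proof -
    let ?E = "expos (n - r) r"
    let ?F = "\<lambda>b. f (unblocks (0 # b))"
    have "?P (0 # z) = (\<Sum>b\<in>?E. ?F b * powmon b z)"
      using z r by (intro gf_Cons_0[OF bihom le]) auto
    moreover have "?P (0 # rotate1 z) = (\<Sum>b\<in>?E. ?F (rotate1 b) * powmon b z)"
      using z r by (subst gf_Cons_0[OF bihom le])
        (auto intro!: sum_expos_permute[where F="?F"] powmon_rotate1 inj_rotate1 sum_list_rotate1)
    moreover have "?P (0 # rotate1 (rotate1 z)) = (\<Sum>b\<in>?E. ?F (rotate1 (rotate1 b)) * powmon b z)"
      using z r by (subst gf_Cons_0[OF bihom le])
        (auto intro!: sum_expos_permute[where F="?F" and p="\<lambda>b. rotate1 (rotate1 b)"]
          injI dest!: injD[OF inj_rotate1] simp: powmon_rotate1 sum_list_rotate1)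
    ultimately have "?P (0 # z) + ?P (0 # rotate1 z) + ?P (0 # rotate1 (rotate1 z))
        = (\<Sum>b\<in>?E. (?F b + ?F (rotate1 b) + ?F (rotate1 (rotate1 b))) * powmon b z)"
      by (simp add: sum.distrib algebra_simps)
    also have "\<dots> = 0"
    proof (intro sum.neutral ballI)
      fix b assume "b \<in> ?E"
      then have "b \<noteq> []" using r by (auto simp: expos_def)
      with neutral have "(\<Sum>i\<le>2. f (unblocks (0 # rotate i b))) = 0"
        unfolding push_neutral_yder_iff by blast
      then show "(?F b + ?F (rotate1 b) + ?F (rotate1 (rotate1 b))) * powmon b z = 0"
        by (simp add: numeral_2_eq_2)
    qed
    finally show ?thesis .
  qed
  have N: "?P [a, b, c, d] + ?P [a, c, d, b] + ?P [a, d, b, c] = 0" for a b c d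
    using 0[of "[b - a, c - a, d - a]"] gf_translate[OF lie, of a "[0, b - a, c - a, d - a]"]
      gf_translate[OF lie, of a "[0, c - a, d - a, b - a]"]
      gf_translate[OF lie, of a "[0, d - a, b - a, c - a]"] by simp
  have "?P [a, b, c, d] = 0" for a b c d
  proof -
    have "?P [c, d, a, b] = ?P [a, b, c, d]" using rot by metis
    moreover have "?P [c, a, b, d] = - ?P [a, c, d, b]" using rot rev by metis
    moreover have "?P [c, b, d, a] = - ?P [a, d, b, c]" using rev by metis
    ultimately show ?thesis using N[of a b c d] N[of c d a b] by linarith
  qed
  then have "f = szero"
    using r by (intro gf_eq_0[OF bihom]) (auto simp: length_Suc_conv numeral_3_eq_3)
  with assms(4) show False by simp
qed

text \<open>In depth 2, neutrality is antisymmetry. In depth 3 the weight is odd, so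
  \<open>piy f\<close> is invariant under reversal, and replacing cab by bac turns the cyclic
  relation into the shuffle of a with bc.\<close>

lemma piy_lie_depth_le_3:
  assumes push: "push f = f" and neutral: "2 \<le> r \<Longrightarrow> push_neutral (r - 1) (yder f)"
    and r: "r \<in> {1, 2, 3}" and nz: "f \<noteq> szero"
  shows "piy f \<in> lie_gen ygens"
proof -
  consider "r = 1" | "r = 2" | "r = 3" using r by auto
  then show ?thesis
  proof cases
    case 1
    then show ?thesis by (rule piy_lie_1)
  next
    case 2
    then have s: "(\<Sum>i\<le>1. piy f (rotate i v)) = 0" for v
      using neutral by (simp add: push_neutral_yder_iff_piy[OF push])
    show ?thesis
    proof (rule piy_lie_2[OF 2])
      fix a b
      show "piy f [a, b] + piy f [b, a] = 0"
        using s[of "[a, b]"] by simp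
    qed
  next
    case 3
    then have n: "push_neutral 2 (yder f)" using neutral by simp
    then have s: "(\<Sum>i\<le>2. piy f (rotate i v)) = 0" for v
      by (simp add: push_neutral_yder_iff_piy[OF push])
    have odd: "odd n" using odd_if_depth_3[OF push n 3 nz] .
    have rev: "piy f (rev v) = piy f v" for v
    proof (cases "v = [] \<or> 0 \<in> set v")
      case False
      define a where "a = map (\<lambda>i. i - 1) v"
      have v: "v = map Suc a" "a \<noteq> []" using False map_Suc_pred[of v] by (auto simp: a_def)
      have "piy f (rev v) = f (unblocks (rev (0 # a)))"
        using v by (simp add: piy_map_Suc rev_map)
      also have "\<dots> = f (unblocks (0 # a))"
        using coeff_rev[of "unblocks (0 # a)"] odd by (simp add: rev_unblocks)
      finally show ?thesis using v coeff_0_Cons[OF push] by simp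
    qed (auto simp: piy_def)
    have rev3: "piy f [c, b, a] = piy f [a, b, c]" for a b c
      using rev[of "[a, b, c]"] by simp
    show ?thesis
    proof (rule piy_lie_3[OF 3])
      fix a b c
      show "piy f [c, b, a] = piy f [a, b, c]" by (rule rev3)
      show "piy f [a, b, c] + piy f [b, a, c] + piy f [b, c, a] = 0"
        using s[of "[a, b, c]"] rev3[of c a b] by (simp add: numeral_2_eq_2)
    qed
  qed
qed

end

section \<open>Comparison of the linearized Lie algebras\<close>

lemma szero_lkv_part: "szero \<in> lkv_part n r"
proof -
  have "bihom n r szero" by (simp add: bihom_def szero_def)
  moreover from this have "szero \<in> lieC"
    by (simp add: lieC_eq lie_compl_bihom lie_gen.zero)
  moreover have "push szero = szero" by (simp add: push_def szero_def)
  moreover have "push_neutral s (yder szero)" for s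
    unfolding push_neutral_yder_iff by (simp add: szero_def)
  ultimately show ?thesis by (simp add: lkv_part_def)
qed

lemma ls_part_subset: "ls_part n r \<subseteq> lkv_part n r"
proof
  fix f assume f: "f \<in> ls_part n r"
  show "f \<in> lkv_part n r"
  proof (cases "f = szero")
    case False
    with f have h: "bihom n r f" "3 \<le> n" "f \<in> lie2" "piy f \<in> lie_gen ygens" "r = 1 \<Longrightarrow> odd n"
      by (auto simp: ls_part_def)
    then have C: "f \<in> lie_gen Cgens" by (intro lie2_bihom_Cgens) auto
    \<comment> \<open>Every C_i has y-degree 1, so depth 0 leaves only the zero series.\<close>
    have "1 \<le> r"
    proof (rule ccontr)
      assume "\<not> 1 \<le> r"
      with h(1) have "f w = 0" for w
        using lie_Cgens_ydeg_0[OF C, of w] by (cases "ydeg w = 0") (auto simp: bihom_def)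
      with False show False by (auto simp: szero_def)
    qed
    interpret bihom_lie f n r
      by unfold_locales (use C h False bihom_ydeg_le in auto)
    have "push f = f" using push_invariant_if_piy_lie h \<open>1 \<le> r\<close> by blast
    moreover have "f \<in> lieC" using C h by (simp add: lieC_eq lie_compl_bihom)
    ultimately show ?thesis
      using h push_neutral_if_piy_lie by (simp add: lkv_part_def)
  qed (simp add: szero_lkv_part)
qed

lemma lkv_part_subset:
  assumes "r \<in> {1, 2, 3}"
  shows "lkv_part n r \<subseteq> ls_part n r"
proof
  fix f assume f: "f \<in> lkv_part n r"
  then have h: "bihom n r f" "f \<in> lieC" "push f = f" "2 \<le> r \<Longrightarrow> push_neutral (r - 1) (yder f)"
    by (auto simp: lkv_part_def)
  show "f \<in> ls_part n r"
  proof (cases "f = szero")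
    case False
    interpret bihom_lie f n r
      by unfold_locales (use h False bihom_ydeg_le in \<open>auto simp: lieC_eq lie_compl_bihom\<close>)
    show ?thesis
      using f h False assms odd_if_depth_1 piy_lie_depth_le_3 lieC_subset_lie2
      by (auto simp: ls_part_def lkv_part_def)
  qed (use h in \<open>simp add: ls_part_def\<close>)
qed

section \<open>The automorphism f(x,y) to f(-x,-y) as the morphism\<close>

definition sign_twist :: "letter ser \<Rightarrow> letter ser" where
  "sign_twist f = (\<lambda>w. (-1) ^ length w * f w)"

lemma sign_twist_bihom: "bihom n r f \<Longrightarrow> sign_twist f = sscale ((-1) ^ n) f"
  by (auto simp: sign_twist_def sscale_def bihom_def fun_eq_iff)

lemma sign_twist_smult: "smult (sign_twist f) (sign_twist g) = sign_twist (smult f g)"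
  using smult_sign[of f g] by (simp add: sign_twist_def fun_eq_iff)

lemma sign_twist_sbr: "sbr (sign_twist f) (sign_twist g) = sign_twist (sbr f g)"
  unfolding sbr_def sign_twist_smult by (simp add: sign_twist_def ssub_def algebra_simps)

lemma sbr_scale_left: "sbr (sscale c f) g = sscale c (sbr f g)"
  by (simp add: ser_defs smult_linear algebra_simps)

text \<open>The derivation replaces a letter y of \<open>g\<close> by [y, f]. The sign of the
  removed y and that of the y in the bracket cancel.\<close>

lemma sign_twist_dpois: "dpois (sign_twist f) (sign_twist g) = sign_twist (dpois f g)"
proof
  fix u
  have "sign_twist ys = sscale (-1) ys"
    by (auto simp: sign_twist_def sscale_def ys_def mono_def)
  then have "sscale (-1) (sbr ys (sign_twist f)) = sign_twist (sbr ys f)"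
    by (simp only: sbr_scale_left flip: sign_twist_sbr)
  then have br: "sbr ys (sign_twist f) v = - ((-1) ^ length v * sbr ys f v)" for v
    by (auto simp: sign_twist_def sscale_def fun_eq_iff minus_equation_iff)
  have s: "(-1::rat) ^ length u = - ((-1) ^ length (take i u @ [Y] @ drop j u) * (-1) ^ length (drop i (take j u)))"
    if "i \<le> j" "j \<le> length u" for i j
  proof -
    have "length (take i u @ [Y] @ drop j u) + length (drop i (take j u)) = Suc (length u)"
      using that by simp
    then show ?thesis by (simp only: flip: power_add) simp
  qed
  show "dpois (sign_twist f) (sign_twist g) u = sign_twist (dpois f g) u"
    unfolding dpois_def dder_def szero_def sign_twist_def[of "\<lambda>u. \<Sum>i\<in>_ u. _ u i"] sum_distrib_left
  proof (intro sum.cong refl)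
    fix i j assume ij: "i \<in> {0..length u}" "j \<in> {i..length u}"
    show "sign_twist g (take i u @ [X] @ drop j u) * 0
        + sign_twist g (take i u @ [Y] @ drop j u) * sbr ys (sign_twist f) (drop i (take j u))
      = (-1) ^ length u * (g (take i u @ [X] @ drop j u) * 0
        + g (take i u @ [Y] @ drop j u) * sbr ys f (drop i (take j u)))"
      using s[of i j] ij unfolding br by (simp add: sign_twist_def)
  qed
qed

lemma sign_twist_pb: "sign_twist (pb f g) = pb (sign_twist f) (sign_twist g)"
  unfolding pb_def sign_twist_dpois sign_twist_sbr
  by (simp add: sign_twist_def sadd_def ssub_def algebra_simps)

text \<open>The substitution can turn x into y but never y into x, so a word other than
  \<open>u\<close> contributes to \<open>u\<close> only if it has fewer letters y.\<close>

lemma subst_coef_prod_eq_0: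
  assumes "length w = length u" "w \<noteq> u" "ydeg u \<le> ydeg w"
  shows "(\<Prod>i<length u. subst_coef (w ! i) (u ! i)) = 0"
proof -
  have "\<exists>i<length u. w ! i = Y \<and> u ! i = X"
  proof (rule ccontr)
    assume no: "\<not> (\<exists>i<length u. w ! i = Y \<and> u ! i = X)"
    have "ydeg w \<le> ydeg u \<and> (w \<noteq> u \<longrightarrow> ydeg w < ydeg u)"
      using assms(1) no
    proof (induction w u rule: list_induct2)
      case (Cons a w b u)
      have "\<not> (\<exists>i<length u. w ! i = Y \<and> u ! i = X)" "\<not> (a = Y \<and> b = X)"
        using Cons.prems by fastforce+
      with Cons.IH show ?case
        by (cases a; cases b) (auto simp: ydeg_def)
    qed simp
    with assms show False by simp
  qed
  then show ?thesis by (intro prod_zero) (auto intro!: bexI)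
qed

lemma subst_coef_prod_self: "(\<Prod>i<length u. subst_coef (u ! i) (u ! i)) = (-1) ^ length u"
proof -
  have "subst_coef a a = -1" for a by (cases a) auto
  then show ?thesis by simp
qed

text \<open>Commutativity of the square: by triangularity in the y-degree only the diagonal term,
  with sign (-1)^length, reaches the lowest depth.\<close>

lemma subst_neg_lowest_depth:
  assumes "\<And>w. ydeg w < r \<Longrightarrow> f w = 0"
  shows "sign_twist (bipart n r f) = bipart n r (subst_neg f)"
proof
  fix u
  have "subst_neg f u = (-1) ^ length u * f u" if "ydeg u = r"
  proof -
    have "finite {w :: letter list. length w = length u}"
    proof -
      have "(UNIV :: letter set) = {X, Y}" using letter.exhaust by auto
      then have "finite (UNIV :: letter set)" by (metis finite.emptyI finite.insertI)
      from finite_lists_length_eq[OF this, of "length u"] show ?thesis by simp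
    qed
    then have "subst_neg f u = (\<Sum>w\<in>{u}. f w * (\<Prod>i<length u. subst_coef (w ! i) (u ! i)))"
      unfolding subst_neg_def
    proof (rule sum.mono_neutral_right)
      show "\<forall>w\<in>{w. length w = length u} - {u}. f w * (\<Prod>i<length u. subst_coef (w ! i) (u ! i)) = 0"
      proof
        fix w assume "w \<in> {w. length w = length u} - {u}"
        then show "f w * (\<Prod>i<length u. subst_coef (w ! i) (u ! i)) = 0"
          using assms[of w] subst_coef_prod_eq_0[of w u] that by (cases "ydeg w < r") auto
      qed
    qed simp
    then show ?thesis by (simp add: subst_coef_prod_self)
  qed
  then show "sign_twist (bipart n r f) u = bipart n r (subst_neg f) u"
    by (auto simp: sign_twist_def bipart_def)
qed

lemma ls_part_scale:
  assumes "f \<in> ls_part n r"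
  shows "sscale c f \<in> ls_part n r"
proof -
  have "piy (sscale c f) = sscale c (piy f)"
    by (auto simp: piy_def sscale_def)
  moreover have "hpart k (sscale c f) = sscale c (hpart k f)" for k
    by (auto simp: hpart_def sscale_def)
  then have "f \<in> lie2 \<Longrightarrow> sscale c f \<in> lie2"
    by (simp add: lie2_def lie_compl_def lie_gen.scale)
  moreover have "sscale c szero = szero" by (simp add: sscale_def szero_def)
  moreover have "bihom n r f \<Longrightarrow> bihom n r (sscale c f)"
    by (simp add: bihom_def sscale_def)
  ultimately show ?thesis
    using assms by (auto simp: ls_part_def lie_gen.scale)
qed

text \<open>The twist is an involution acting by the scalar (-1)^n on each part.\<close>

lemma sign_twist_ls_part: "sign_twist ` ls_part n r = ls_part n r"
proof -
  have "sign_twist f \<in> ls_part n r" if "f \<in> ls_part n r" for f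
    using that ls_part_scale[of f n r] sign_twist_bihom[of n r f] by (auto simp: ls_part_def)
  moreover have "sign_twist (sign_twist f) = f" for f
    by (simp add: sign_twist_def fun_eq_iff flip: power_mult_distrib mult.assoc)
  ultimately show ?thesis by (metis image_subsetI rev_image_eqI subsetI subset_antisym)
qed

theorem theorem3:
  shows "\<exists>\<phi> :: letter ser \<Rightarrow> letter ser.
    (\<forall>n r. \<forall>f\<in>ls_part n r. \<phi> f \<in> lkv_part n r) \<and>
    (\<forall>f\<in>LS. \<forall>g\<in>LS. \<phi> (sadd f g) = sadd (\<phi> f) (\<phi> g)) \<and>
    (\<forall>c. \<forall>f\<in>LS. \<phi> (sscale c f) = sscale c (\<phi> f)) \<and>
    inj_on \<phi> LS \<and>
    (\<forall>f\<in>LS. \<forall>g\<in>LS. \<phi> (pb f g) = pb (\<phi> f) (\<phi> g)) \<and>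
    (\<forall>f\<in>ds. \<forall>r. (\<forall>w. ydeg w < r \<longrightarrow> f w = 0) \<longrightarrow>
        (\<forall>n. \<phi> (bipart n r f) = bipart n r (subst_neg f))) \<and>
    (\<forall>n r. 3 \<le> n \<and> r \<in> {1, 2, 3} \<longrightarrow> \<phi> ` ls_part n r = lkv_part n r)"
proof (intro exI[of _ sign_twist] conjI allI ballI impI)
  fix n r f assume "f \<in> ls_part n r"
  then show "sign_twist f \<in> lkv_part n r"
    using sign_twist_ls_part ls_part_subset by blast
next
  fix n r :: nat assume "3 \<le> n \<and> r \<in> {1, 2, 3}"
  then show "sign_twist ` ls_part n r = lkv_part n r"
    using sign_twist_ls_part ls_part_subset lkv_part_subset by blast
next
  show "inj_on sign_twist LS"
    by (auto simp: inj_on_def sign_twist_def fun_eq_iff)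
qed (auto simp: sign_twist_pb subst_neg_lowest_depth,
  auto simp: sign_twist_def sadd_def sscale_def algebra_simps)

end
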